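(* Let $n,p\ge 1$ and let $\mathcal{M}\in\mathbb{C}^{2n\times 2n\times p}$. Assume that for each $i=1,\dots,p$ the Fourier-domain slice $\widehat{\boldsymbol{M}}^{(i)}$ of $\mathcal{M}$ is a real symmetric positive-definite matrix. Then there exist a T-symplectic tensor $\mathcal{S}\in\mathbb{C}^{2n\times 2n\times p}$ and a T-diagonal tensor $\mathcal{D}\in\mathbb{C}^{2n\times 2n\times p}$ such that $$\mathcal{M}=\mathcal{S}^H*\mathcal{D}*\mathcal{S},$$ and, moreover, for each $i=1,\dots,p$ the $i$-th Fourier-domain slice of $\mathcal{D}$ has the form $$\widehat{\boldsymbol{D}}^{(i)}=\begin{bmatrix}\widehat{\boldsymbol{\Lambda}}^{(i)} & \boldsymbol{0}\\ \boldsymbol{0} & \widehat{\boldsymbol{\Lambda}}^{(i)}\end{bmatrix},\qquad \widehat{\boldsymbol{\Lambda}}^{(i)}=\operatorname{diag}(\lambda_1^{(i)},\dots,\lambda_n^{(i)}),$$ with $\lambda_j^{(i)}>0$ for $j=1,\dots,n$.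
   Context: A tensor $\mathcal{A}\in\mathbb{C}^{m\times n\times p}$ has frontal slices $\boldsymbol{A}^{(1)},\dots,\boldsymbol{A}^{(p)}\in\mathbb{C}^{m\times n}$. With $\omega=e^{2\pi\sqrt{-1}/p}$, its Fourier-domain slices are $\widehat{\boldsymbol{A}}^{(i)}=\sum_{j=1}^{p}\omega^{(i-1)(j-1)}\boldsymbol{A}^{(j)}$, $i=1,\dots,p$, with inverse $\boldsymbol{A}^{(j)}=\frac1p\sum_{i=1}^p\omega^{-(i-1)(j-1)}\widehat{\boldsymbol{A}}^{(i)}$. Let $\operatorname{bcirc}(\mathcal{A})\in\mathbb{C}^{mp\times np}$ be the block circulant matrix whose $(r,s)$ block is $\boldsymbol{A}^{(((r-s)\bmod p)+1)}$. The T-product $\mathcal{A}*\mathcal{B}$ is the tensor with $\operatorname{bcirc}(\mathcal{A}*\mathcal{B})=\operatorname{bcirc}(\mathcal{A})\operatorname{bcirc}(\mathcal{B})$; equivalently, if $\mathcal{C}=\mathcal{A}*\mathcal{B}$ then $\widehat{\boldsymbol{C}}^{(i)}=\widehat{\boldsymbol{A}}^{(i)}\widehat{\boldsymbol{B}}^{(i)}$ for all $i$. The T-conjugate transpose $\mathcal{A}^H$ has frontal slices $(\boldsymbol{A}^{(1)})^H$ for $k=1$ and $(\boldsymbol{A}^{(p-k+2)})^H$ for $k\ge2$ (so that $\operatorname{bcirc}(\mathcal{A}^H)=\operatorname{bcirc}(\mathcal{A})^H$). Let $\boldsymbol{J}=\begin{bmatrix}\boldsymbol{0}&\boldsymbol{I}_n\\-\boldsymbol{I}_n&\boldsymbol{0}\end{bmatrix}$.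 The T-symplectic unit tensor $\mathcal{J}\in\mathbb{R}^{2n\times2n\times p}$ is the tensor all of whose Fourier-domain slices equal $\boldsymbol{J}$. A tensor $\mathcal{S}\in\mathbb{C}^{2n\times2n\times p}$ is T-symplectic if $\mathcal{S}^H*\mathcal{J}*\mathcal{S}=\mathcal{J}$. A tensor $\mathcal{D}$ with square frontal slices is T-diagonal if each Fourier-domain slice $\widehat{\boldsymbol{D}}^{(i)}$ is a diagonal matrix. *)

theory Defs
  imports Complex_Main "Jordan_Normal_Form.Schur_Decomposition"
begin

text \<open>
  A third-order tensor of size m x n x p is the list of its p frontal slices. Slices, blocks and
  matrix entries are all numbered from 0, so \<open>A ! k\<close> is the slice usually written \<open>A\<^sup>(\<^sup>k\<^sup>+\<^sup>1\<^sup>)\<close>.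
\<close>

type_synonym ctensor = "complex mat list"

definition carrier_tensor :: "nat \<Rightarrow> nat \<Rightarrow> nat \<Rightarrow> ctensor set" where
  "carrier_tensor m n p = {A. length A = p \<and> set A \<subseteq> carrier_mat m n}"

text \<open>The sizes below are read off slice 0; they are meaningful for tensors with \<open>p \<ge> 1\<close>.\<close>

definition trows :: "ctensor \<Rightarrow> nat" where
  "trows A = dim_row (A ! 0)"

definition tcols :: "ctensor \<Rightarrow> nat" where
  "tcols A = dim_col (A ! 0)"

definition root_unity :: "nat \<Rightarrow> complex" where
  "root_unity p = exp (2 * complex_of_real pi * \<i> / of_nat p)"

definition fourier_slice :: "ctensor \<Rightarrow> nat \<Rightarrow> complex mat" where
  "fourier_slice A i = mat (trows A) (tcols A)
     (\<lambda>(r, c). \<Sum>j<length A. root_unity (length A) ^ (i * j) * (A ! j) $$ (r, c))"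

definition inverse_fourier :: "nat \<Rightarrow> nat \<Rightarrow> nat \<Rightarrow> (nat \<Rightarrow> complex mat) \<Rightarrow> ctensor" where
  "inverse_fourier m n p F = map (\<lambda>j. mat m n
     (\<lambda>(r, c). 1 / of_nat p * (\<Sum>i<p. inverse (root_unity p) ^ (i * j) * F i $$ (r, c)))) [0..<p]"

text \<open>
  In \<open>bcirc\<close>, row r lies in block row \<open>r div m\<close> and column s in block column \<open>s div n\<close>. The summand
  \<open>length A\<close> in the slice index keeps the natural-number subtraction from truncating.
\<close>

definition bcirc :: "ctensor \<Rightarrow> complex mat" where
  "bcirc A = mat (trows A * length A) (tcols A * length A)
     (\<lambda>(r, s). (A ! ((r div trows A + length A - s div tcols A) mod length A))
        $$ (r mod trows A, s mod tcols A))"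

text \<open>Existence and uniqueness of the T-product are the lemmas \<open>tprod\<close> and \<open>bcirc_inject\<close>.\<close>

definition tprod :: "ctensor \<Rightarrow> ctensor \<Rightarrow> ctensor" (infixl \<open>*\<^sub>T\<close> 70) where
  "A *\<^sub>T B = (THE C. C \<in> carrier_tensor (trows A) (tcols B) (length A) \<and>
                    bcirc C = bcirc A * bcirc B)"

definition tadjoint :: "ctensor \<Rightarrow> ctensor" where
  "tadjoint A = map (\<lambda>k. mat_adjoint (A ! (if k = 0 then 0 else length A - k))) [0..<length A]"

definition symplectic_J :: "nat \<Rightarrow> complex mat" where
  "symplectic_J n = four_block_mat (0\<^sub>m n n) (1\<^sub>m n) (- 1\<^sub>m n) (0\<^sub>m n n)"

text \<open>All Fourier-domain slices of the next tensor equal \<open>symplectic_J n\<close>, see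
  \<open>fourier_slice_tsymplectic_unit\<close>.\<close>

definition tsymplectic_unit :: "nat \<Rightarrow> nat \<Rightarrow> ctensor" where
  "tsymplectic_unit n p = inverse_fourier (2 * n) (2 * n) p (\<lambda>i. symplectic_J n)"

definition T_symplectic :: "nat \<Rightarrow> nat \<Rightarrow> ctensor \<Rightarrow> bool" where
  "T_symplectic n p S \<longleftrightarrow> S \<in> carrier_tensor (2 * n) (2 * n) p \<and>
     tadjoint S *\<^sub>T tsymplectic_unit n p *\<^sub>T S = tsymplectic_unit n p"

definition T_diagonal :: "ctensor \<Rightarrow> bool" where
  "T_diagonal D \<longleftrightarrow> (\<exists>n. D \<in> carrier_tensor n n (length D)) \<and>
     (\<forall>i<length D. diagonal_mat (fourier_slice D i))"

definition real_sym_pos_def :: "complex mat \<Rightarrow> bool" where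
  "real_sym_pos_def M \<longleftrightarrow> (\<exists>n (R :: real mat). R \<in> carrier_mat n n \<and>
     M = map_mat complex_of_real R \<and> transpose_mat R = R \<and>
     (\<forall>x \<in> carrier_vec n. x \<noteq> 0\<^sub>v n \<longrightarrow> x \<bullet> (R *\<^sub>v x) > 0))"


subsection \<open>Well-definedness of the T-product\<close>

lemma carrier_tensorD:
  assumes "A \<in> carrier_tensor m n p"
  shows "length A = p" and "k < p \<Longrightarrow> A ! k \<in> carrier_mat m n"
    and "p \<ge> 1 \<Longrightarrow> trows A = m" and "p \<ge> 1 \<Longrightarrow> tcols A = n"
proof -
  show l: "length A = p" using assms by (auto simp: carrier_tensor_def)
  show *: "A ! k \<in> carrier_mat m n" if "k < p" for k
    using assms l that nth_mem[of k A] by (auto simp: carrier_tensor_def)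
  show "p \<ge> 1 \<Longrightarrow> trows A = m" "p \<ge> 1 \<Longrightarrow> tcols A = n"
    using *[of 0] by (auto simp: trows_def tcols_def)
qed

lemma carrier_tensor_mapI:
  assumes "\<And>k. k < p \<Longrightarrow> f k \<in> carrier_mat m n"
  shows "map f [0..<p] \<in> carrier_tensor m n p"
  using assms by (auto simp: carrier_tensor_def)

lemma block_index_less: "a < m \<Longrightarrow> q < p \<Longrightarrow> q * m + a < m * (p::nat)"
proof -
  assume "a < m" "q < p"
  then have "q * m + a < Suc q * m" by simp
  also have "\<dots> \<le> p * m" using \<open>q < p\<close> by (intro mult_le_mono1) simp
  finally show ?thesis by (simp add: mult.commute)
qed

lemma bcirc_entry:
  assumes A: "A \<in> carrier_tensor m n p" and "a < m" "b < n" "q < p" "s < p"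
  shows "bcirc A $$ (q * m + a, s * n + b) = (A ! ((q + p - s) mod p)) $$ (a, b)"
  using assms(2-) carrier_tensorD[OF A] block_index_less[of a m q p] block_index_less[of b n s p]
  by (simp add: bcirc_def)

lemma bcirc_carrier:
  assumes "A \<in> carrier_tensor m n p" "p \<ge> 1"
  shows "bcirc A \<in> carrier_mat (m * p) (n * p)"
  using carrier_tensorD[OF assms(1)] assms(2) by (simp add: bcirc_def)

lemma bcirc_inject:
  assumes C: "C \<in> carrier_tensor m n p" and C': "C' \<in> carrier_tensor m n p"
    and eq: "bcirc C = bcirc C'"
  shows "C = C'"
proof (rule nth_equalityI)
  show "length C = length C'" using C C' by (simp add: carrier_tensor_def)
  fix k assume "k < length C"
  then have k: "k < p" using C by (simp add: carrier_tensor_def)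
  show "C ! k = C' ! k"
  proof (rule eq_matI)
    fix a b assume "a < dim_row (C' ! k)" "b < dim_col (C' ! k)"
    then have "a < m" "b < n" using carrier_tensorD(2)[OF C' k] by auto
    then show "C ! k $$ (a, b) = C' ! k $$ (a, b)"
      using bcirc_entry[OF C, of a b k 0] bcirc_entry[OF C', of a b k 0] k eq by simp
  qed (use carrier_tensorD(2)[OF C k] carrier_tensorD(2)[OF C' k] in auto)
qed

definition tconv :: "nat \<Rightarrow> nat \<Rightarrow> nat \<Rightarrow> nat \<Rightarrow> ctensor \<Rightarrow> ctensor \<Rightarrow> ctensor" where
  "tconv m n l p A B = map (\<lambda>k. mat m l (\<lambda>(a, b).
     \<Sum>j<p. \<Sum>t<n. A ! ((k + p - j) mod p) $$ (a, t) * B ! j $$ (t, b))) [0..<p]"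

lemma sum_blocks:
  fixes f :: "nat \<Rightarrow> 'a::comm_monoid_add"
  shows "(\<Sum>k<n * p. f k) = (\<Sum>q<p. \<Sum>t<n. f (q * n + t))"
proof -
  have "sum f {q * n..<q * n + n} = (\<Sum>t<n. f (q * n + t))" for q
    using sum.shift_bounds_nat_ivl[of f 0 "q * n" n] by (simp add: atLeast0LessThan add.commute)
  then show ?thesis
    using sum.nat_group[of f n p] by (simp add: mult.commute)
qed

lemma mod_less_twice: "(x::nat) < 2 * p \<Longrightarrow> x mod p = (if x < p then x else x - p)"
  by (auto simp: mod_if)

lemma bcirc_tconv:
  assumes A: "A \<in> carrier_tensor m n p" and B: "B \<in> carrier_tensor n l p" and p: "p \<ge> 1"
  shows "bcirc (tconv m n l p A B) = bcirc A * bcirc B"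
proof (rule eq_matI)
  have C: "tconv m n l p A B \<in> carrier_tensor m l p"
    unfolding tconv_def by (rule carrier_tensor_mapI) simp
  note cA = bcirc_carrier[OF A p] and cB = bcirc_carrier[OF B p] and cC = bcirc_carrier[OF C p]
  show "dim_row (bcirc (tconv m n l p A B)) = dim_row (bcirc A * bcirc B)"
    and "dim_col (bcirc (tconv m n l p A B)) = dim_col (bcirc A * bcirc B)"
    using cA cB cC by auto
  fix r s assume "r < dim_row (bcirc A * bcirc B)" "s < dim_col (bcirc A * bcirc B)"
  then have rs: "r < m * p" "s < l * p" using cA cB by auto
  then have ml: "m > 0" "l > 0" by (auto intro: Nat.gr0I)
  define r1 r2 s1 s2 where "r1 = r div m" and "r2 = r mod m" and "s1 = s div l" and "s2 = s mod l"
  have r: "r = r1 * m + r2" and s: "s = s1 * l + s2"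
    and b: "r2 < m" "s2 < l" "r1 < p" "s1 < p"
    using rs ml by (auto simp: r1_def r2_def s1_def s2_def less_mult_imp_div_less mult.commute)
  let ?k = "(r1 + p - s1) mod p"
  let ?g = "\<lambda>x y. \<Sum>t<n. A ! x $$ (r2, t) * B ! y $$ (t, s2)"
  have "(bcirc A * bcirc B) $$ (r, s) = (\<Sum>k<n * p. bcirc A $$ (r, k) * bcirc B $$ (k, s))"
    using cA cB rs by (auto simp: scalar_prod_def atLeast0LessThan)
  also have "\<dots> = (\<Sum>q<p. \<Sum>t<n. bcirc A $$ (r, q * n + t) * bcirc B $$ (q * n + t, s))"
    by (rule sum_blocks)
  also have "\<dots> = (\<Sum>q<p. ?g ((r1 + p - q) mod p) ((q + p - s1) mod p))"
    by (intro sum.cong refl) (use b in \<open>simp add: r s bcirc_entry[OF A] bcirc_entry[OF B]\<close>)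
  also have "\<dots> = (\<Sum>j<p. ?g ((?k + p - j) mod p) j)"
  proof (rule sum.reindex_bij_witness[where i = "\<lambda>j. (j + s1) mod p" and j = "\<lambda>q. (q + p - s1) mod p"])
    fix q assume "q \<in> {..<p}"
    then have q: "q < p" by simp
    show "((q + p - s1) mod p + s1) mod p = q"
      using q b by (auto simp: mod_less_twice)
    show "(q + p - s1) mod p \<in> {..<p}" "(q + s1) mod p \<in> {..<p}" using p by auto
    show "((q + s1) mod p + p - s1) mod p = q"
      using q b by (auto simp: mod_less_twice)
    have "(?k + p - (q + p - s1) mod p) mod p = (r1 + p - q) mod p"
      using q b by (auto simp: mod_less_twice)
    then show "?g ((?k + p - (q + p - s1) mod p) mod p) ((q + p - s1) mod p)
        = ?g ((r1 + p - q) mod p) ((q + p - s1) mod p)" by simp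
  qed
  also have "\<dots> = bcirc (tconv m n l p A B) $$ (r, s)"
    using b p by (simp add: r s bcirc_entry[OF C]) (simp add: tconv_def)
  finally show "bcirc (tconv m n l p A B) $$ (r, s) = (bcirc A * bcirc B) $$ (r, s)" by simp
qed

lemma tprod_eq_tconv:
  assumes A: "A \<in> carrier_tensor m n p" and B: "B \<in> carrier_tensor n l p" and p: "p \<ge> 1"
  shows "A *\<^sub>T B = tconv m n l p A B"
  unfolding tprod_def carrier_tensorD(1)[OF A] carrier_tensorD(3)[OF A p] carrier_tensorD(4)[OF B p]
proof (rule the_equality)
  have C: "tconv m n l p A B \<in> carrier_tensor m l p"
    unfolding tconv_def by (rule carrier_tensor_mapI) simp
  then show "tconv m n l p A B \<in> carrier_tensor m l p \<and>
      bcirc (tconv m n l p A B) = bcirc A * bcirc B"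
    using bcirc_tconv[OF assms] by simp
  then show "\<And>C. C \<in> carrier_tensor m l p \<and> bcirc C = bcirc A * bcirc B \<Longrightarrow>
      C = tconv m n l p A B"
    using bcirc_inject by metis
qed

lemma tprod:
  assumes "A \<in> carrier_tensor m n p" and "B \<in> carrier_tensor n l p" and "p \<ge> 1"
  shows "A *\<^sub>T B \<in> carrier_tensor m l p" and "bcirc (A *\<^sub>T B) = bcirc A * bcirc B"
proof -
  show "bcirc (A *\<^sub>T B) = bcirc A * bcirc B"
    using assms by (simp add: tprod_eq_tconv bcirc_tconv)
  show "A *\<^sub>T B \<in> carrier_tensor m l p"
    unfolding tprod_eq_tconv[OF assms] tconv_def by (rule carrier_tensor_mapI) simp
qed

lemma mat_adjoint_dims [simp]:
  "dim_row (mat_adjoint A) = dim_col A" "dim_col (mat_adjoint A) = dim_row A"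
  by (auto simp: mat_adjoint_def)

lemma mat_adjoint_entry:
  "i < dim_col A \<Longrightarrow> j < dim_row A \<Longrightarrow> mat_adjoint A $$ (i, j) = conjugate (A $$ (j, i))"
  by (simp add: mat_adjoint_def mat_of_rows_def)

lemma tadjoint_carrier:
  assumes A: "A \<in> carrier_tensor m n p"
  shows "tadjoint A \<in> carrier_tensor n m p"
  unfolding tadjoint_def carrier_tensorD(1)[OF A]
proof (rule carrier_tensor_mapI)
  fix k assume "k < p"
  then have "A ! (if k = 0 then 0 else p - k) \<in> carrier_mat m n"
    using carrier_tensorD(2)[OF A] by auto
  then show "mat_adjoint (A ! (if k = 0 then 0 else p - k)) \<in> carrier_mat n m"
    unfolding carrier_mat_def by (simp split del: if_split)
qed

lemma bcirc_tadjoint: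
  assumes A: "A \<in> carrier_tensor m n p" and p: "p \<ge> 1"
  shows "bcirc (tadjoint A) = mat_adjoint (bcirc A)"
proof (rule eq_matI)
  note T = tadjoint_carrier[OF A]
  note cA = bcirc_carrier[OF A p] and cT = bcirc_carrier[OF T p]
  show "dim_row (bcirc (tadjoint A)) = dim_row (mat_adjoint (bcirc A))"
    and "dim_col (bcirc (tadjoint A)) = dim_col (mat_adjoint (bcirc A))" using cA cT by auto
  fix r s assume "r < dim_row (mat_adjoint (bcirc A))" "s < dim_col (mat_adjoint (bcirc A))"
  then have rs: "r < n * p" "s < m * p" using cA by auto
  then have ml: "m > 0" "n > 0" by (auto intro: Nat.gr0I)
  define r1 r2 s1 s2 where "r1 = r div n" and "r2 = r mod n" and "s1 = s div m" and "s2 = s mod m"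
  have r: "r = r1 * n + r2" and s: "s = s1 * m + s2"
    and b: "r2 < n" "s2 < m" "r1 < p" "s1 < p"
    using rs ml by (auto simp: r1_def r2_def s1_def s2_def less_mult_imp_div_less mult.commute)
  let ?k = "(r1 + p - s1) mod p" and ?k' = "(s1 + p - r1) mod p"
  have k: "?k < p" and k': "?k' < p" using p by auto
  have idx: "(if ?k = 0 then 0 else p - ?k) = ?k'" using b by (auto simp: mod_less_twice)
  have "bcirc (tadjoint A) $$ (r, s) = mat_adjoint (A ! ?k') $$ (r2, s2)"
    using b k by (simp add: r s bcirc_entry[OF T] idx[symmetric] split del: if_split)
      (simp add: tadjoint_def carrier_tensorD(1)[OF A])
  also have "\<dots> = conjugate (bcirc A $$ (s, r))"
    using b carrier_tensorD(2)[OF A k'] by (simp add: mat_adjoint_entry r s bcirc_entry[OF A])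
  also have "\<dots> = mat_adjoint (bcirc A) $$ (r, s)" using cA rs by (simp add: mat_adjoint_entry)
  finally show "bcirc (tadjoint A) $$ (r, s) = mat_adjoint (bcirc A) $$ (r, s)" .
qed


subsection \<open>The T-symplectic unit\<close>

lemma root_unity_power: "root_unity p ^ k = exp (2 * of_real pi * \<i> * of_nat k / of_nat p)"
  by (simp add: root_unity_def exp_of_nat_mult[symmetric] algebra_simps)

lemma root_unity_power_p: "p \<ge> 1 \<Longrightarrow> root_unity p ^ p = 1"
  using exp_two_pi_i by (simp add: root_unity_power)

lemma root_unity_power_neq_1:
  assumes "0 < j" "j < p"
  shows "root_unity p ^ j \<noteq> 1"
proof
  let ?f = "\<lambda>k. cis (2 * pi * real k / real p)"
  have inj: "inj_on ?f {..<p}"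
    using bij_betw_roots_unity[of p] assms by (auto simp: bij_betw_def)
  have "root_unity p ^ j = ?f j"
    by (simp add: root_unity_power cis_conv_exp algebra_simps)
  moreover assume "root_unity p ^ j = 1"
  ultimately have "?f j = ?f 0" by simp
  then have "j = 0" by (rule inj_onD[OF inj]) (use assms in auto)
  then show False using assms by simp
qed

lemma tsymplectic_unit_nth:
  assumes "j < p"
  shows "tsymplectic_unit n p ! j = (if j = 0 then symplectic_J n else 0\<^sub>m (2 * n) (2 * n))"
proof -
  let ?w = "inverse (root_unity p)"
  have J: "symplectic_J n \<in> carrier_mat (2 * n) (2 * n)"
    unfolding symplectic_J_def carrier_mat_def by simp
  have "(\<Sum>i<p. ?w ^ (i * j)) = (if j = 0 then of_nat p else 0)"
  proof (cases "j = 0")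
    case False
    have "?w ^ j \<noteq> 1" using root_unity_power_neq_1[of j p] assms False
      by (metis inverse_1 inverse_inverse_eq power_inverse bot_nat_0.not_eq_extremum)
    moreover have "(?w ^ j) ^ p = 1"
      using root_unity_power_p[of p] assms
      by (simp add: power_mult[symmetric] mult.commute[of j] power_inverse) (simp add: power_mult)
    ultimately have "(\<Sum>i<p. (?w ^ j) ^ i) = 0" by (simp add: geometric_sum)
    then show ?thesis using False by (simp add: power_mult[symmetric] mult.commute)
  qed simp
  then have "1 / of_nat p * (\<Sum>i<p. ?w ^ (i * j) * x) = (if j = 0 then x else 0)" for x
    using assms by (simp add: sum_distrib_right[symmetric])
  then show ?thesis using assms J
    by (auto simp: tsymplectic_unit_def inverse_fourier_def intro!: eq_matI)
qed

lemma tsymplectic_unit_carrier: "tsymplectic_unit n p \<in> carrier_tensor (2 * n) (2 * n) p"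
  unfolding tsymplectic_unit_def inverse_fourier_def by (rule carrier_tensor_mapI) simp

lemma fourier_slice_tsymplectic_unit:
  assumes "i < p"
  shows "fourier_slice (tsymplectic_unit n p) i = symplectic_J n"
proof -
  have p: "p \<ge> 1" using assms by simp
  note D = carrier_tensorD[OF tsymplectic_unit_carrier[of n p]]
  have J: "symplectic_J n \<in> carrier_mat (2 * n) (2 * n)"
    unfolding symplectic_J_def carrier_mat_def by simp
  have "(\<Sum>j<p. root_unity p ^ (i * j) * tsymplectic_unit n p ! j $$ (r, c)) = symplectic_J n $$ (r, c)"
    if "r < 2 * n" "c < 2 * n" for r c
  proof -
    have "(\<Sum>j<p. root_unity p ^ (i * j) * tsymplectic_unit n p ! j $$ (r, c))
        = (\<Sum>j<p. if j = 0 then symplectic_J n $$ (r, c) else 0)"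
      using that by (intro sum.cong refl) (auto simp: tsymplectic_unit_nth)
    then show ?thesis using p by simp
  qed
  then show ?thesis using J p D
    by (auto simp: fourier_slice_def intro!: eq_matI)
qed

end

theory Submission
  imports Defs
begin

text \<open>
  The discrete Fourier transform turns T-products into slicewise matrix products and T-conjugate
  transposes into slicewise adjoints, so it suffices to prove Williamson's theorem for each slice and
  to transform back. For one slice \<open>M\<close>, factor \<open>M = L\<^sup>H L\<close> and put \<open>K = \<i>J\<close>, which is Hermitian and
  skew-symmetric. As \<open>M\<close> is symmetric, the Hermitian matrix \<open>B = L\<^sup>-\<^sup>H K L\<^sup>-\<^sup>1\<close> has the same
  characteristic polynomial as \<open>-B\<close>; it is invertible, so its eigenvalues can be listed as
  \<open>m\<^sub>1, \<dots>, m\<^sub>n, -m\<^sub>1, \<dots>, -m\<^sub>n\<close> with all \<open>m\<^sub>j > 0\<close>. Diagonalising \<open>B\<close> unitarily with its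
  eigenvalues in this order gives \<open>W\<close> with \<open>M = W\<^sup>H W\<close> and \<open>K = W\<^sup>H diag(m, -m) W\<close>. An
  explicit \<open>R\<close> with four diagonal blocks satisfies \<open>R\<^sup>H diag(1/m, 1/m) R = 1\<close> and
  \<open>R\<^sup>H K R = diag(m, -m)\<close>, so \<open>S = R W\<close> is the required symplectic matrix.
\<close>

subsection \<open>Adjoints and unitary diagonalisation\<close>

lemma mat_adjoint_carrier [simp]:
  "A \<in> carrier_mat m n \<Longrightarrow> mat_adjoint A \<in> carrier_mat n m"
  by (intro carrier_matI) simp_all

lemma mat_adjoint_adjoint [simp]: "mat_adjoint (mat_adjoint A) = A"
  by (rule eq_matI) (simp_all add: mat_adjoint_entry)

lemma mat_adjoint_mult:
  assumes A: "A \<in> carrier_mat m k" and B: "B \<in> carrier_mat k l"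
  shows "mat_adjoint (A * B) = mat_adjoint B * mat_adjoint A"
proof (rule eq_matI)
  fix i j assume "i < dim_row (mat_adjoint B * mat_adjoint A)" "j < dim_col (mat_adjoint B * mat_adjoint A)"
  then have ij: "i < l" "j < m" using A B by auto
  have "mat_adjoint (A * B) $$ (i, j) = conjugate (\<Sum>t<k. A $$ (j, t) * B $$ (t, i))"
    using A B ij by (simp add: mat_adjoint_entry scalar_prod_def atLeast0LessThan)
  also have "\<dots> = (\<Sum>t<k. mat_adjoint B $$ (i, t) * mat_adjoint A $$ (t, j))"
    using A B ij by (simp add: sum_conjugate conjugate_dist_mul mat_adjoint_entry mult.commute)
  also have "\<dots> = (mat_adjoint B * mat_adjoint A) $$ (i, j)"
    using A B ij by (simp add: scalar_prod_def atLeast0LessThan)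
  finally show "mat_adjoint (A * B) $$ (i, j) = (mat_adjoint B * mat_adjoint A) $$ (i, j)" .
qed (use A B in auto)

lemma mat_adjoint_one [simp]: "mat_adjoint (1\<^sub>m n :: complex mat) = 1\<^sub>m n"
  by (rule eq_matI) (simp_all add: mat_adjoint_entry)

text \<open>Applied to a Hermitian \<open>A\<close>, this shows that a congruence keeps a matrix
  Hermitian.\<close>

lemma mat_adjoint_congruence:
  assumes A: "A \<in> carrier_mat n n" and X: "X \<in> carrier_mat n m"
  shows "mat_adjoint (mat_adjoint X * A * X) = mat_adjoint X * mat_adjoint A * X"
proof -
  have "mat_adjoint (mat_adjoint X * A * X) = mat_adjoint X * mat_adjoint (mat_adjoint X * A)"
    using A X by (intro mat_adjoint_mult[of _ m n _ m]) auto
  also have "mat_adjoint (mat_adjoint X * A) = mat_adjoint A * mat_adjoint (mat_adjoint X)"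
    using A X by (intro mat_adjoint_mult[of _ m n _ n]) auto
  finally show ?thesis using A X by (simp add: assoc_mult_mat[of _ m n _ n _ m])
qed

text \<open>Congruences compose. Reassociation is done here once, so that later arguments can work
  with whole congruences; with \<open>A\<close> the identity it also handles products
  \<open>X\<^sup>H X\<close>.\<close>

lemma mult_mat_congruence:
  assumes A: "A \<in> carrier_mat n n" and X: "X \<in> carrier_mat n m" and Y: "Y \<in> carrier_mat m k"
  shows "mat_adjoint (X * Y) * A * (X * Y) = mat_adjoint Y * (mat_adjoint X * A * X) * Y"
proof -
  have XH: "mat_adjoint X \<in> carrier_mat m n" and YH: "mat_adjoint Y \<in> carrier_mat k m"
    using X Y by auto
  have "mat_adjoint Y * (mat_adjoint X * A * X) * Y = mat_adjoint Y * (mat_adjoint X * A * X * Y)"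
    using A X Y XH YH by (intro assoc_mult_mat[of _ k m _ m _ k]) auto
  also have "mat_adjoint X * A * X * Y = mat_adjoint X * A * (X * Y)"
    using A X Y XH by (intro assoc_mult_mat[of _ m n _ m _ k]) auto
  also have "mat_adjoint Y * (mat_adjoint X * A * (X * Y)) = mat_adjoint Y * (mat_adjoint X * A) * (X * Y)"
    using A X Y XH YH by (intro assoc_mult_mat[symmetric, of _ k m _ n _ k]) auto
  also have "mat_adjoint Y * (mat_adjoint X * A) = mat_adjoint Y * mat_adjoint X * A"
    using A XH YH by (intro assoc_mult_mat[symmetric, of _ k m _ n _ n]) auto
  finally show ?thesis using mat_adjoint_mult[OF X Y] by simp
qed

lemma mat_adjoint_four_block:
  assumes "A \<in> carrier_mat nr1 nc1" "B \<in> carrier_mat nr1 nc2"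
    "C \<in> carrier_mat nr2 nc1" "D \<in> carrier_mat nr2 nc2"
  shows "mat_adjoint (four_block_mat A B C D) =
    four_block_mat (mat_adjoint A) (mat_adjoint C) (mat_adjoint B) (mat_adjoint D)"
proof (rule eq_matI)
  fix i j assume "i < dim_row (four_block_mat (mat_adjoint A) (mat_adjoint C) (mat_adjoint B) (mat_adjoint D))"
    "j < dim_col (four_block_mat (mat_adjoint A) (mat_adjoint C) (mat_adjoint B) (mat_adjoint D))"
  then have "i < nc1 + nc2" "j < nr1 + nr2" using assms by auto
  then show "mat_adjoint (four_block_mat A B C D) $$ (i, j) =
    four_block_mat (mat_adjoint A) (mat_adjoint C) (mat_adjoint B) (mat_adjoint D) $$ (i, j)"
    using assms by (simp add: mat_adjoint_entry)
qed (use assms in auto)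

section \<open>Unitary matrices and the spectral theorem for Hermitian matrices\<close>

lemma unitary_right:
  fixes U :: "complex mat"
  assumes "U \<in> carrier_mat n n" "mat_adjoint U * U = 1\<^sub>m n"
  shows "U * mat_adjoint U = 1\<^sub>m n"
  using mat_mult_left_right_inverse[of "mat_adjoint U" n U] assms by simp

text \<open>Complete \<open>v\<close> to a basis, orthogonalise by Gram-Schmidt, which keeps the
  first vector, and normalise. The factor \<open>c\<close> is the reciprocal of the norm of
  \<open>v\<close>.\<close>

lemma unitary_completion:
  fixes v :: "complex vec"
  assumes v: "v \<in> carrier_vec n" and v0: "v \<noteq> 0\<^sub>v n"
  shows "\<exists>U\<in>carrier_mat n n. mat_adjoint U * U = 1\<^sub>m n \<and> (\<exists>c. col U 0 = c \<cdot>\<^sub>v v)"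
proof -
  interpret cof_vec_space n "TYPE(complex)" .
  define b where "b = basis_completion v"
  define ws where "ws = gram_schmidt n b"
  from basis_completion[OF v v0, folded b_def]
  have dist_b: "distinct b" and indep: "\<not> lin_dep (set b)" and b: "set b \<subseteq> carrier_vec n"
    and hdb: "hd b = v" and len_b: "length b = n" by auto
  have n: "n \<noteq> 0" using v v0 by (metis eq_vecI carrier_vecD index_zero_vec(2) less_nat_zero_code)
  from hdb len_b n obtain vs where bv: "b = v # vs" by (cases b, auto)
  from gram_schmidt_result[OF b dist_b indep refl, folded ws_def]
  have ws: "set ws \<subseteq> carrier_vec n" "corthogonal ws" "length ws = n"
    by (auto simp: len_b)
  from gram_schmidt_hd[OF v, of vs, folded bv] have hdws: "hd ws = v" unfolding ws_def .
  then have ws0: "ws ! 0 = v" using ws n by (metis hd_conv_nth list.size(3))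
  have wsc: "ws ! i \<in> carrier_vec n" if "i < n" for i using ws that by auto
  \<comment> \<open>The norm of the \<open>i\<close>-th basis vector. The inner product is complex
    valued, hence the passage through \<open>Re\<close> and back.\<close>
  define s where "s i = complex_of_real (sqrt (Re (ws ! i \<bullet>c ws ! i)))" for i
  have s: "ws ! i \<bullet>c ws ! i = s i * s i" "s i \<noteq> 0" if i: "i < n" for i
  proof -
    have "ws ! i \<bullet>c ws ! i \<noteq> 0" using corthogonalD[OF ws(2), of i i] i ws(3) by simp
    moreover have "ws ! i \<bullet>c ws ! i \<ge> 0" using conjugate_square_ge_0_vec[of "ws ! i"] by simp
    ultimately have *: "Re (ws ! i \<bullet>c ws ! i) > 0" "Im (ws ! i \<bullet>c ws ! i) = 0"
      by (auto simp: less_eq_complex_def complex_eq_iff)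
    then show "ws ! i \<bullet>c ws ! i = s i * s i" "s i \<noteq> 0"
      by (auto simp: s_def complex_eq_iff)
  qed
  define U where "U = mat n n (\<lambda>(i, j). ws ! j $ i / s j)"
  have U: "U \<in> carrier_mat n n" by (simp add: U_def)
  have "mat_adjoint U * U = 1\<^sub>m n"
  proof (rule eq_matI)
    fix i j assume "i < dim_row (1\<^sub>m n :: complex mat)" "j < dim_col (1\<^sub>m n :: complex mat)"
    then have ij: "i < n" "j < n" by auto
    have "(mat_adjoint U * U) $$ (i, j) = (\<Sum>k<n. cnj (ws ! i $ k / s i) * (ws ! j $ k / s j))"
      using U ij by (simp add: scalar_prod_def mat_adjoint_entry atLeast0LessThan)
        (simp add: U_def)
    \<comment> \<open>The product \<open>\<bullet>c\<close> conjugates its second argument, so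
      \<open>i\<close> and \<open>j\<close> change places; the norms are real and unaffected by
      conjugation.\<close>
    also have "\<dots> = (ws ! j \<bullet>c ws ! i) / (s i * s j)"
      using carrier_vecD[OF wsc[OF ij(1)]] ij by (auto simp: scalar_prod_def sum_divide_distrib atLeast0LessThan s_def
          mult_ac intro!: sum.cong)
    also have "\<dots> = 1\<^sub>m n $$ (i, j)"
      using s[OF ij(1)] corthogonalD[OF ws(2), of j i] ij ws(3) by auto
    finally show "(mat_adjoint U * U) $$ (i, j) = 1\<^sub>m n $$ (i, j)" .
  qed (use U in auto)
  moreover have "col U 0 = inverse (s 0) \<cdot>\<^sub>v v"
    using n v ws0 by (intro eq_vecI) (auto simp: U_def divide_inverse)
  ultimately show ?thesis using U by blast
qed

text \<open>Induction on the list of eigenvalues: split off the first one with a unitary basis that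
  starts with an eigenvector, then treat the remaining diagonal block. The list is given in advance,
  so the order of the diagonal entries can be prescribed; their reality comes out on the
  way.\<close>

lemma hermitian_congruence_diag:
  fixes A :: "complex mat"
  assumes "A \<in> carrier_mat n n" and "mat_adjoint A = A"
    and "char_poly A = (\<Prod>e\<leftarrow>es. [:- e, 1:])"
  shows "\<exists>U\<in>carrier_mat n n. mat_adjoint U * U = 1\<^sub>m n \<and>
    mat_adjoint U * A * U = mat_diag n ((!) es) \<and> set es \<subseteq> \<real>"
  using assms
proof (induction es arbitrary: n A)
  case Nil
  then have "n = 0" using degree_monic_char_poly[of A n] by simp
  with Nil show ?case
    by (intro bexI[of _ "1\<^sub>m 0"] conjI eq_matI) (auto simp: mat_diag_def)
next
  case (Cons e es n A)
  note A = Cons.prems(1)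
  have cp: "char_poly A = [:- e, 1:] * (\<Prod>e\<leftarrow>es. [:- e, 1:])" using Cons.prems by simp
  have e: "eigenvalue A e" unfolding eigenvalue_root_char_poly[OF A] cp by simp
  then obtain v where v: "v \<in> carrier_vec n" "v \<noteq> 0\<^sub>v n" "A *\<^sub>v v = e \<cdot>\<^sub>v v"
    using A by (auto simp: eigenvalue_def eigenvector_def)
  then have "n \<noteq> 0" by (metis eq_vecI carrier_vecD index_zero_vec(2) less_nat_zero_code)
  then obtain k where n: "n = Suc k" by (cases n) auto
  from unitary_completion[OF v(1,2)] obtain W c where W: "W \<in> carrier_mat n n"
    and WW: "mat_adjoint W * W = 1\<^sub>m n" and col: "col W 0 = c \<cdot>\<^sub>v v" by blast
  \<comment> \<open>In the new basis the first column is \<open>e\<close> times the first unit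
    vector, and because \<open>A'\<close> is Hermitian its first row has the same shape. So
    \<open>A'\<close> is block diagonal.\<close>
  define A' where "A' = mat_adjoint W * A * W"
  have A': "A' \<in> carrier_mat n n" unfolding A'_def using A W by (intro carrier_matI) simp_all
  have herm: "mat_adjoint A' = A'"
    using mat_adjoint_congruence[OF A W] Cons.prems(2) by (simp add: A'_def)
  have WH: "mat_adjoint W \<in> carrier_mat n n" and n0: "0 < n" using W n by simp_all
  have colW: "col W 0 \<in> carrier_vec n" using v by (simp add: col)
  have "col A' 0 = mat_adjoint W *\<^sub>v (A *\<^sub>v col W 0)"
    unfolding A'_def assoc_mult_mat[OF WH A W] col_mult2[OF WH mult_carrier_mat[OF A W] n0]
      col_mult2[OF A W n0] ..
  also have "A *\<^sub>v col W 0 = e \<cdot>\<^sub>v col W 0"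
    using v A by (simp add: col mult_mat_vec[of _ n n] smult_smult_assoc mult.commute)
  also have "mat_adjoint W *\<^sub>v \<dots> = e \<cdot>\<^sub>v col (mat_adjoint W * W) 0"
    unfolding mult_mat_vec[OF WH colW] col_mult2[OF WH W n0] ..
  finally have eigcol: "col A' 0 = e \<cdot>\<^sub>v unit_vec n 0" using WW n by simp
  have col0: "A' $$ (i, 0) = (if i = 0 then e else 0)" if "i < n" for i
    using arg_cong[OF eigcol, of "\<lambda>u. u $ i"] that A' n by (simp add: unit_vec_def)
  have row0: "A' $$ (0, i) = conjugate (A' $$ (i, 0))" if "i < n" for i
    using mat_adjoint_entry[of 0 A' i] herm A' that n by simp
  \<comment> \<open>A diagonal entry of a Hermitian matrix is its own conjugate.\<close>
  have real: "e \<in> \<real>" using col0[of 0] row0[of 0] n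
    by (metis Reals_cnj_iff conjugate_complex_def zero_less_Suc)
  define E where "E = mat 1 1 (\<lambda>_. e)"
  define A3 where "A3 = mat k k (\<lambda>(i, j). A' $$ (Suc i, Suc j))"
  have E: "E \<in> carrier_mat 1 1" and A3: "A3 \<in> carrier_mat k k" by (auto simp: E_def A3_def)
  have A'eq: "A' = four_block_mat E (0\<^sub>m 1 k) (0\<^sub>m k 1) A3"
    by (rule eq_matI) (use A' n col0 row0 real in \<open>auto simp: E_def A3_def Reals_cnj_iff\<close>)
  have "mat_adjoint A3 = A3"
  proof (rule eq_matI)
    fix i j assume "i < dim_row A3" "j < dim_col A3"
    then have ij: "i < k" "j < k" using A3 by auto
    then show "mat_adjoint A3 $$ (i, j) = A3 $$ (i, j)"
      using mat_adjoint_entry[of "Suc i" A' "Suc j"] A' n herm A3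
      by (simp add: mat_adjoint_entry) (simp add: A3_def)
  qed (use A3 in auto)
  \<comment> \<open>The characteristic polynomial of \<open>A'\<close> splits along the blocks; the
    factor belonging to \<open>e\<close> can be cancelled.\<close>
  moreover have "char_poly A3 = (\<Prod>e\<leftarrow>es. [:- e, 1:])"
  proof -
    have "similar_mat A' A"
      using A A' W WW unitary_right[OF W WW]
      by (intro similar_matI[of _ _ "mat_adjoint W" W n]) (auto simp: A'_def)
    then have "char_poly A' = [:- e, 1:] * (\<Prod>e\<leftarrow>es. [:- e, 1:])" using char_poly_similar cp by metis
    also have "char_poly A' = char_poly E * char_poly A3"
      unfolding A'eq by (rule char_poly_four_block_zeros_col[OF E _ A3]) simp
    also have "char_poly E = [:- e, 1:]" by (simp add: E_def char_poly_defs det_def sign_def)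
    finally show ?thesis by (metis mult_cancel_left pCons_eq_0_iff zero_neq_one)
  qed
  ultimately obtain V where V: "V \<in> carrier_mat k k" and VV: "mat_adjoint V * V = 1\<^sub>m k"
    and VA: "mat_adjoint V * A3 * V = mat_diag k ((!) es)" and es: "set es \<subseteq> \<real>"
    using Cons.IH[OF A3] by blast
  \<comment> \<open>Bordering \<open>V\<close> by a 1 leaves \<open>e\<close> in place, so
    \<open>W * P\<close> diagonalises \<open>A\<close>.\<close>
  define P where "P = four_block_mat (1\<^sub>m 1) (0\<^sub>m 1 k) (0\<^sub>m k 1) V"
  have P: "P \<in> carrier_mat n n" using V n unfolding P_def by (metis four_block_carrier_mat one_carrier_mat plus_1_eq_Suc)
  have PH: "mat_adjoint P = four_block_mat (1\<^sub>m 1) (0\<^sub>m 1 k) (0\<^sub>m k 1) (mat_adjoint V)"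
    unfolding P_def using V by (subst mat_adjoint_four_block[of _ 1 1 _ k _ k]) (auto intro!: eq_matI cong_four_block_mat simp: mat_adjoint_entry)
  have PP: "mat_adjoint P * P = 1\<^sub>m n"
    unfolding PH unfolding P_def using V VV n
    by (subst mult_four_block_mat[of _ 1 1 _ k _ k _ _ 1 _ k]) auto
  have VA3: "mat_adjoint V * A3 \<in> carrier_mat k k" using V A3 by (intro carrier_matI) simp_all
  have "mat_adjoint P * A' = four_block_mat E (0\<^sub>m 1 k) (0\<^sub>m k 1) (mat_adjoint V * A3)"
    unfolding PH A'eq using V A3 E VA3
    by (subst mult_four_block_mat[of _ 1 1 _ k _ k _ _ 1 _ k]) auto
  then have "mat_adjoint P * A' * P = four_block_mat E (0\<^sub>m 1 k) (0\<^sub>m k 1) (mat_diag k ((!) es))"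
    using V E VA3 VA unfolding P_def
    by (simp only:) (subst mult_four_block_mat[of _ 1 1 _ k _ k _ _ 1 _ k], auto)
  also have "\<dots> = mat_diag n ((!) (e # es))"
    by (rule eq_matI) (auto simp: mat_diag_def E_def n nth_Cons split: nat.splits)
  finally have "mat_adjoint (W * P) * A * (W * P) = mat_diag n ((!) (e # es))"
    using mult_mat_congruence[OF A W P] by (simp add: A'_def)
  moreover have "mat_adjoint (W * P) * (W * P) = 1\<^sub>m n"
    using mult_mat_congruence[of "1\<^sub>m n" n W n P n] W P WW PP by simp
  moreover have "W * P \<in> carrier_mat n n" using W P by simp
  ultimately show ?case using es real by auto
qed

subsection \<open>The Fourier transform of a tensor\<close>

lemma fourier_slice_carrier:
  assumes "A \<in> carrier_tensor m n p" "p \<ge> 1"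
  shows "fourier_slice A i \<in> carrier_mat m n"
  using carrier_tensorD[OF assms(1)] assms(2) by (simp add: fourier_slice_def)

lemma fourier_slice_entry:
  assumes "A \<in> carrier_tensor m n p" "p \<ge> 1" "r < m" "c < n"
  shows "fourier_slice A i $$ (r, c) = (\<Sum>j<p. root_unity p ^ (i * j) * A ! j $$ (r, c))"
  using carrier_tensorD[OF assms(1)] assms(2-) by (simp add: fourier_slice_def)

lemma inverse_fourier_carrier: "inverse_fourier m n p F \<in> carrier_tensor m n p"
  unfolding inverse_fourier_def by (rule carrier_tensor_mapI) simp

section \<open>Orthogonality of the powers of the root of unity\<close>

lemma root_unity_neq_0 [simp]: "root_unity p \<noteq> 0"
  by (simp add: root_unity_def)

lemma cnj_root_unity: "cnj (root_unity p) = inverse (root_unity p)"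
proof -
  have "root_unity p = cis (2 * pi / real p)"
    by (simp add: root_unity_def cis_conv_exp mult_ac)
  then show ?thesis by (simp add: cis_cnj cis_inverse)
qed

lemma root_unity_power_inj:
  assumes "j < p" "k < p" "root_unity p ^ j = root_unity p ^ k"
  shows "j = k"
  using assms
proof (induction j k rule: linorder_wlog)
  case (le j k)
  then have "root_unity p ^ j * root_unity p ^ (k - j) = root_unity p ^ j * 1"
    by (metis le_add_diff_inverse mult.right_neutral power_add)
  then have "root_unity p ^ (k - j) = 1" by simp
  then show ?case using root_unity_power_neq_1[of "k - j" p] le by (cases "k = j") auto
next
  case (sym a b)
  then show ?case by simp
qed

text \<open>The sum is geometric with ratio \<open>x\<close>, a \<open>p\<close>-th root of unity
  that equals 1 exactly when \<open>j = k\<close>.\<close>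

lemma root_unity_orthogonal:
  assumes "j < p" "k < p"
  shows "(\<Sum>i<p. inverse (root_unity p) ^ (i * j) * root_unity p ^ (i * k))
    = (if j = k then of_nat p else 0)"
proof -
  let ?w = "root_unity p"
  define x where "x = inverse ?w ^ j * ?w ^ k"
  have p: "p \<ge> 1" using assms by simp
  have "inverse ?w ^ (i * j) * ?w ^ (i * k) = x ^ i" for i
    by (simp add: x_def power_mult_distrib power_mult[symmetric] mult.commute)
  then have eq: "(\<Sum>i<p. inverse ?w ^ (i * j) * ?w ^ (i * k)) = (\<Sum>i<p. x ^ i)" by simp
  show ?thesis
  proof (cases "j = k")
    case True
    then have "x = 1" by (simp add: x_def power_mult_distrib[symmetric])
    then show ?thesis unfolding eq using True by simp
  next
    case False
    have "x \<noteq> 1"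
      using root_unity_power_inj[OF assms] False by (auto simp: x_def power_inverse field_simps)
    moreover have "x ^ p = 1"
      using root_unity_power_p[OF p]
      by (simp add: x_def power_mult_distrib power_inverse power_mult[symmetric] mult.commute[of _ p])
        (simp add: power_mult)
    ultimately show ?thesis using False by (simp add: eq geometric_sum)
  qed
qed

section \<open>Fourier inversion\<close>

text \<open>Interchange the two sums and apply orthogonality. This allows a tensor to be defined by
  prescribing its Fourier-domain slices.\<close>

lemma fourier_slice_inverse_fourier:
  assumes "i < p" "F i \<in> carrier_mat m n"
  shows "fourier_slice (inverse_fourier m n p F) i = F i"
proof (rule eq_matI)
  note C = inverse_fourier_carrier[of m n p F]
  let ?w = "root_unity p"
  have p: "p \<ge> 1" using assms by simp
  fix r c assume "r < dim_row (F i)" "c < dim_col (F i)"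
  then have rc: "r < m" "c < n" using assms by auto
  have "fourier_slice (inverse_fourier m n p F) i $$ (r, c)
    = (\<Sum>j<p. ?w ^ (i * j) * (1 / of_nat p * (\<Sum>k<p. inverse ?w ^ (k * j) * F k $$ (r, c))))"
    using rc by (simp add: fourier_slice_entry[OF C p]) (simp add: inverse_fourier_def)
  also have "\<dots> = (\<Sum>j<p. \<Sum>k<p. 1 / of_nat p * F k $$ (r, c) * (inverse ?w ^ (j * k) * ?w ^ (j * i)))"
    by (simp add: sum_distrib_left mult_ac)
  also have "\<dots> = (\<Sum>k<p. 1 / of_nat p * F k $$ (r, c) * (\<Sum>j<p. inverse ?w ^ (j * k) * ?w ^ (j * i)))"
    by (subst sum.swap) (simp add: sum_distrib_left)
  also have "\<dots> = (\<Sum>k<p. if k = i then F k $$ (r, c) else 0)"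
    using assms(1) p by (intro sum.cong refl) (simp add: root_unity_orthogonal)
  finally show "fourier_slice (inverse_fourier m n p F) i $$ (r, c) = F i $$ (r, c)"
    using assms(1) by simp
qed (use fourier_slice_carrier[OF inverse_fourier_carrier[of m n p F], of i] assms in auto)

text \<open>Summing the Fourier-domain slices against inverse powers recovers \<open>p\<close> times
  a frontal slice. Hence tensor identities may be checked slice by slice in the Fourier
  domain.\<close>

lemma fourier_slice_inject:
  assumes A: "A \<in> carrier_tensor m n p" and B: "B \<in> carrier_tensor m n p"
    and eq: "\<And>i. i < p \<Longrightarrow> fourier_slice A i = fourier_slice B i"
  shows "A = B"
proof (rule nth_equalityI)
  show "length A = length B" using A B by (simp add: carrier_tensor_def)
  fix k assume "k < length A"
  then have k: "k < p" using A by (simp add: carrier_tensor_def)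
  then have p: "p \<ge> 1" by simp
  let ?w = "root_unity p"
  have inv: "(\<Sum>i<p. inverse ?w ^ (i * k) * fourier_slice C i $$ (r, c)) = of_nat p * C ! k $$ (r, c)"
    if C: "C \<in> carrier_tensor m n p" and rc: "r < m" "c < n" for C r c
  proof -
    have "(\<Sum>i<p. inverse ?w ^ (i * k) * fourier_slice C i $$ (r, c))
        = (\<Sum>i<p. \<Sum>j<p. C ! j $$ (r, c) * (inverse ?w ^ (i * k) * ?w ^ (i * j)))"
      using rc by (simp add: fourier_slice_entry[OF C p] sum_distrib_left mult_ac)
    also have "\<dots> = (\<Sum>j<p. C ! j $$ (r, c) * (\<Sum>i<p. inverse ?w ^ (i * k) * ?w ^ (i * j)))"
      by (subst sum.swap) (simp add: sum_distrib_left)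
    also have "\<dots> = (\<Sum>j<p. if j = k then of_nat p * C ! j $$ (r, c) else 0)"
      using k by (intro sum.cong refl) (simp add: root_unity_orthogonal)
    finally show ?thesis using k by simp
  qed
  show "A ! k = B ! k"
  proof (rule eq_matI)
    fix r c assume "r < dim_row (B ! k)" "c < dim_col (B ! k)"
    then have rc: "r < m" "c < n" using carrier_tensorD(2)[OF B k] by auto
    have "of_nat p * A ! k $$ (r, c) = of_nat p * B ! k $$ (r, c)"
      using eq by (simp add: inv[OF A rc, symmetric] inv[OF B rc, symmetric])
    then show "A ! k $$ (r, c) = B ! k $$ (r, c)" using p by simp
  qed (use carrier_tensorD(2)[OF A k] carrier_tensorD(2)[OF B k] in auto)
qed

section \<open>Products and adjoints under the transform\<close>

lemma root_unity_power_mod: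
  assumes "p \<ge> 1"
  shows "root_unity p ^ (i * (k mod p)) = root_unity p ^ (i * k)"
proof -
  have "root_unity p ^ k = root_unity p ^ (p * (k div p) + k mod p)" by simp
  also have "\<dots> = root_unity p ^ (k mod p)"
    using root_unity_power_p[OF assms] by (simp only: power_add power_mult) simp
  finally show ?thesis by (simp add: power_mult mult.commute[of i])
qed

text \<open>The convolution theorem: the T-product is a cyclic convolution of frontal slices, and a
  cyclic shift only multiplies the transform by a power of the root of unity.\<close>

lemma fourier_slice_tprod:
  assumes A: "A \<in> carrier_tensor m n p" and B: "B \<in> carrier_tensor n l p" and p: "p \<ge> 1"
  shows "fourier_slice (A *\<^sub>T B) i = fourier_slice A i * fourier_slice B i"
proof (rule eq_matI)
  let ?w = "root_unity p"
  note C = tprod(1)[OF assms]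
  note cA = fourier_slice_carrier[OF A p, of i] and cB = fourier_slice_carrier[OF B p, of i]
  fix r c assume "r < dim_row (fourier_slice A i * fourier_slice B i)"
    "c < dim_col (fourier_slice A i * fourier_slice B i)"
  then have rc: "r < m" "c < l" using cA cB by auto
  \<comment> \<open>Substitute \<open>q = k - j\<close> modulo \<open>p\<close>; the added
    \<open>p\<close> keeps the subtraction from truncating.\<close>
  have shift: "(\<Sum>k<p. ?w ^ (i * k) * A ! ((k + p - j) mod p) $$ (r, t))
      = ?w ^ (i * j) * fourier_slice A i $$ (r, t)" if j: "j < p" and t: "t < n" for j t
  proof -
    have "(\<Sum>k<p. ?w ^ (i * k) * A ! ((k + p - j) mod p) $$ (r, t))
        = (\<Sum>q<p. ?w ^ (i * ((q + j) mod p)) * A ! q $$ (r, t))"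
    proof (rule sum.reindex_bij_witness[where i = "\<lambda>q. (q + j) mod p" and j = "\<lambda>k. (k + p - j) mod p"])
      fix k assume "k \<in> {..<p}"
      then have k: "k < p" by simp
      show inv: "((k + p - j) mod p + j) mod p = k" using k j by (auto simp: mod_less_twice)
      show "(k + p - j) mod p \<in> {..<p}" "(k + j) mod p \<in> {..<p}" using p by auto
      show "((k + j) mod p + p - j) mod p = k" using k j by (auto simp: mod_less_twice)
      show "?w ^ (i * (((k + p - j) mod p + j) mod p)) * A ! ((k + p - j) mod p) $$ (r, t)
        = ?w ^ (i * k) * A ! ((k + p - j) mod p) $$ (r, t)" by (simp only: inv)
    qed
    also have "\<dots> = ?w ^ (i * j) * (\<Sum>q<p. ?w ^ (i * q) * A ! q $$ (r, t))"
      using p by (simp add: root_unity_power_mod sum_distrib_left distrib_left power_add mult_ac)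
    finally show ?thesis using t rc by (simp add: fourier_slice_entry[OF A p])
  qed
  have "fourier_slice (A *\<^sub>T B) i $$ (r, c)
      = (\<Sum>k<p. ?w ^ (i * k) * (\<Sum>j<p. \<Sum>t<n. A ! ((k + p - j) mod p) $$ (r, t) * B ! j $$ (t, c)))"
    using rc by (simp add: fourier_slice_entry[OF C p]) (simp add: tprod_eq_tconv[OF assms] tconv_def)
  also have "\<dots> = (\<Sum>k<p. \<Sum>j<p. \<Sum>t<n. ?w ^ (i * k) * A ! ((k + p - j) mod p) $$ (r, t) * B ! j $$ (t, c))"
    by (simp add: sum_distrib_left mult.assoc)
  \<comment> \<open>The sum over \<open>k\<close> is moved innermost, where \<open>shift\<close>
    evaluates it.\<close>
  also have "\<dots> = (\<Sum>j<p. \<Sum>k<p. \<Sum>t<n. ?w ^ (i * k) * A ! ((k + p - j) mod p) $$ (r, t) * B ! j $$ (t, c))"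
    by (rule sum.swap)
  also have "\<dots> = (\<Sum>j<p. \<Sum>t<n. \<Sum>k<p. ?w ^ (i * k) * A ! ((k + p - j) mod p) $$ (r, t) * B ! j $$ (t, c))"
    by (intro sum.cong refl sum.swap)
  also have "\<dots> = (\<Sum>j<p. \<Sum>t<n. fourier_slice A i $$ (r, t) * (?w ^ (i * j) * B ! j $$ (t, c)))"
    by (intro sum.cong refl) (simp add: sum_distrib_right[symmetric] shift)
  also have "\<dots> = (\<Sum>t<n. fourier_slice A i $$ (r, t) * fourier_slice B i $$ (t, c))"
    using rc by (subst sum.swap) (simp add: sum_distrib_left[symmetric] fourier_slice_entry[OF B p])
  also have "\<dots> = (fourier_slice A i * fourier_slice B i) $$ (r, c)"
    using cA cB rc by (simp add: scalar_prod_def atLeast0LessThan)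
  finally show "fourier_slice (A *\<^sub>T B) i $$ (r, c) = (fourier_slice A i * fourier_slice B i) $$ (r, c)" .
qed (use fourier_slice_carrier[OF A p, of i] fourier_slice_carrier[OF B p, of i]
      fourier_slice_carrier[OF tprod(1)[OF assms] p, of i] in auto)

text \<open>The T-conjugate transpose reverses the slice index modulo \<open>p\<close>. As the root
  of unity has modulus 1, this reversal conjugates its powers, which supplies the conjugation in the
  slicewise adjoint.\<close>

lemma fourier_slice_tadjoint:
  assumes A: "A \<in> carrier_tensor m n p" and p: "p \<ge> 1"
  shows "fourier_slice (tadjoint A) i = mat_adjoint (fourier_slice A i)"
proof (rule eq_matI)
  let ?w = "root_unity p" and ?neg = "\<lambda>k. if k = 0 then 0 else p - k"
  note T = tadjoint_carrier[OF A]
  note cA = fourier_slice_carrier[OF A p, of i]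
  fix r c assume "r < dim_row (mat_adjoint (fourier_slice A i))" "c < dim_col (mat_adjoint (fourier_slice A i))"
  then have rc: "r < n" "c < m" using cA by auto
  \<comment> \<open>Since \<open>?neg k + k\<close> is 0 or \<open>p\<close>, the power at the
    reversed index is the inverse power, hence the conjugate one.\<close>
  have w: "?w ^ (i * ?neg k) = cnj ?w ^ (i * k)" if "k < p" for k
  proof -
    have "?w ^ (?neg k) * ?w ^ k = 1"
      using that root_unity_power_p[OF p] by (simp add: power_add[symmetric])
    then have "?w ^ (?neg k) = cnj ?w ^ k"
      by (simp add: cnj_root_unity power_inverse field_simps split del: if_split)
    then show ?thesis by (simp only: mult.commute[of i] power_mult)
  qed
  have "fourier_slice (tadjoint A) i $$ (r, c) = (\<Sum>k<p. ?w ^ (i * k) * cnj (A ! (?neg k) $$ (c, r)))"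
    unfolding fourier_slice_entry[OF T p rc]
  proof (intro sum.cong refl)
    fix k assume "k \<in> {..<p}"
    then have k: "k < p" "?neg k < p" by auto
    have "tadjoint A ! k = mat_adjoint (A ! ?neg k)"
      using k(1) by (simp add: tadjoint_def carrier_tensorD(1)[OF A])
    then show "?w ^ (i * k) * tadjoint A ! k $$ (r, c) = ?w ^ (i * k) * cnj (A ! (?neg k) $$ (c, r))"
      using carrier_tensorD(2)[OF A k(2)] rc by (simp add: mat_adjoint_entry split del: if_split)
  qed
  also have "\<dots> = (\<Sum>k<p. ?w ^ (i * ?neg k) * cnj (A ! k $$ (c, r)))"
    by (rule sum.reindex_bij_witness[where i = ?neg and j = ?neg]) auto
  also have "\<dots> = cnj (fourier_slice A i $$ (c, r))"
    using rc by (simp add: fourier_slice_entry[OF A p] w split del: if_split)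
  also have "\<dots> = mat_adjoint (fourier_slice A i) $$ (r, c)"
    using cA rc by (simp add: mat_adjoint_entry)
  finally show "fourier_slice (tadjoint A) i $$ (r, c) = mat_adjoint (fourier_slice A i) $$ (r, c)" .
qed (use fourier_slice_carrier[OF A p, of i] fourier_slice_carrier[OF tadjoint_carrier[OF A] p, of i] in auto)

subsection \<open>Matrices with four diagonal blocks\<close>

text \<open>Up to a permutation of the basis, these are direct sums of \<open>n\<close> matrices of
  size 2 x 2. Identities between them therefore reduce to scalar identities at each index.\<close>

definition diag_blocks :: "nat \<Rightarrow> (nat \<Rightarrow> complex) \<Rightarrow> (nat \<Rightarrow> complex) \<Rightarrow> (nat \<Rightarrow> complex) \<Rightarrow>
    (nat \<Rightarrow> complex) \<Rightarrow> complex mat" where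
  "diag_blocks n a b c d = four_block_mat (mat_diag n a) (mat_diag n b) (mat_diag n c) (mat_diag n d)"

lemma diag_blocks_carrier [simp]: "diag_blocks n a b c d \<in> carrier_mat (2 * n) (2 * n)"
  unfolding diag_blocks_def mult_2 by simp

lemma diag_blocks_cong:
  assumes "\<And>j. j < n \<Longrightarrow> a j = a' j" "\<And>j. j < n \<Longrightarrow> b j = b' j"
    "\<And>j. j < n \<Longrightarrow> c j = c' j" "\<And>j. j < n \<Longrightarrow> d j = d' j"
  shows "diag_blocks n a b c d = diag_blocks n a' b' c' d'"
proof -
  have *: "mat_diag n f = mat_diag n g" if "\<And>j. j < n \<Longrightarrow> f j = g j" for f g :: "nat \<Rightarrow> complex"
    using that by (intro eq_matI) (simp_all add: mat_diag_def)
  show ?thesis unfolding diag_blocks_def using assms by (intro cong_four_block_mat *)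
qed

lemma mat_diag_add: "mat_diag n f + mat_diag n g = mat_diag n (\<lambda>i. f i + g i :: 'a::monoid_add)"
  by (rule eq_matI) (simp_all add: mat_diag_def)

lemma mat_adjoint_mat_diag: "mat_adjoint (mat_diag n f) = mat_diag n (\<lambda>i. cnj (f i))"
  by (rule eq_matI) (simp_all add: mat_diag_def mat_adjoint_entry)

lemma diag_blocks_mult:
  "diag_blocks n a b c d * diag_blocks n a' b' c' d' =
    diag_blocks n (\<lambda>i. a i * a' i + b i * c' i) (\<lambda>i. a i * b' i + b i * d' i)
      (\<lambda>i. c i * a' i + d i * c' i) (\<lambda>i. c i * b' i + d i * d' i)"
  unfolding diag_blocks_def
  by (subst mult_four_block_mat[of _ n n _ n _ n _ _ n _ n]) (simp_all add: mat_diag_add)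

lemma diag_blocks_adjoint:
  "mat_adjoint (diag_blocks n a b c d) =
    diag_blocks n (\<lambda>i. cnj (a i)) (\<lambda>i. cnj (c i)) (\<lambda>i. cnj (b i)) (\<lambda>i. cnj (d i))"
  unfolding diag_blocks_def
  by (subst mat_adjoint_four_block[of _ n n _ n _ n]) (simp_all add: mat_adjoint_mat_diag)

lemma symplectic_J_eq: "symplectic_J n = diag_blocks n (\<lambda>_. 0) (\<lambda>_. 1) (\<lambda>_. -1) (\<lambda>_. 0)"
proof -
  have "0\<^sub>m n n = mat_diag n (\<lambda>_. 0 :: complex)" "- 1\<^sub>m n = mat_diag n (\<lambda>_. - 1 :: complex)"
    by (auto intro!: eq_matI simp: mat_diag_def)
  then show ?thesis by (simp add: symplectic_J_def diag_blocks_def)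
qed

lemma diag_blocks_smult:
  "k \<cdot>\<^sub>m diag_blocks n a b c d =
    diag_blocks n (\<lambda>i. k * a i) (\<lambda>i. k * b i) (\<lambda>i. k * c i) (\<lambda>i. k * d i)"
proof -
  have "k \<cdot>\<^sub>m mat_diag n f = mat_diag n (\<lambda>i. k * f i)" for f :: "nat \<Rightarrow> complex"
    by (rule eq_matI) (simp_all add: mat_diag_def)
  then show ?thesis
    unfolding diag_blocks_def by (subst smult_four_block_mat[of _ n n _ n _ n]) simp_all
qed

lemma diag_blocks_one: "1\<^sub>m (2 * n) = diag_blocks n (\<lambda>_. 1) (\<lambda>_. 0) (\<lambda>_. 0) (\<lambda>_. 1)"
proof -
  have "0\<^sub>m n n = mat_diag n (\<lambda>_. 0 :: complex)" by (auto intro!: eq_matI simp: mat_diag_def)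
  then show ?thesis unfolding diag_blocks_def mult_2 four_block_one_mat[symmetric] by simp
qed

lemma mat_diag_append:
  assumes "length xs = n" "length ys = n"
  shows "mat_diag (2 * n) ((!) (xs @ ys)) = diag_blocks n ((!) xs) (\<lambda>_. 0) (\<lambda>_. 0) ((!) ys)"
  unfolding diag_blocks_def
  by (rule eq_matI) (use assms in \<open>auto simp: mat_diag_def nth_append\<close>)

subsection \<open>Williamson's theorem\<close>

text \<open>The definition tests real vectors only. For \<open>x = a + \<i> b\<close> the real part
  of the Hermitian form is the sum of the real forms at \<open>a\<close> and at \<open>b\<close>,
  and one of these vectors is nonzero.\<close>

lemma real_sym_pos_defD:
  assumes M: "M \<in> carrier_mat N N" and pd: "real_sym_pos_def M"
  shows "mat_adjoint M = M" and "transpose_mat M = M"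
    and "x \<in> carrier_vec N \<Longrightarrow> x \<noteq> 0\<^sub>v N \<Longrightarrow> Re (conjugate x \<bullet> (M *\<^sub>v x)) > 0"
proof -
  from pd obtain n and R :: "real mat" where R: "R \<in> carrier_mat n n"
    and MR: "M = map_mat complex_of_real R" and sym: "transpose_mat R = R"
    and pos: "\<And>x. x \<in> carrier_vec n \<Longrightarrow> x \<noteq> 0\<^sub>v n \<Longrightarrow> x \<bullet> (R *\<^sub>v x) > 0"
    unfolding real_sym_pos_def_def by blast
  have n: "n = N" using M R MR by (metis carrier_matD(1) index_map_mat(2))
  have symR: "R $$ (i, j) = R $$ (j, i)" if "i < N" "j < N" for i j
    using arg_cong[OF sym, of "\<lambda>X. X $$ (i, j)"] that R n by simp
  show "mat_adjoint M = M" "transpose_mat M = M"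
    by (rule eq_matI; use R n symR in \<open>simp add: MR mat_adjoint_entry\<close>)+
  assume x: "x \<in> carrier_vec N" and x0: "x \<noteq> 0\<^sub>v N"
  define a b where "a = map_vec Re x" and "b = map_vec Im x"
  have ab: "a \<in> carrier_vec N" "b \<in> carrier_vec N" using x by (auto simp: a_def b_def)
  have nn: "y \<bullet> (R *\<^sub>v y) \<ge> 0" if "y \<in> carrier_vec N" for y
    using pos[of y] that n R by (cases "y = 0\<^sub>v N") (auto simp: less_imp_le)
  have q: "y \<bullet> (R *\<^sub>v z) = (\<Sum>i<N. \<Sum>j<N. R $$ (i, j) * (y $ i * z $ j))"
    if "y \<in> carrier_vec N" "z \<in> carrier_vec N" for y z
    using that R n by (auto simp: scalar_prod_def atLeast0LessThan sum_distrib_left mult_ac intro!: sum.cong)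
  have "conjugate x \<bullet> (M *\<^sub>v x) = (\<Sum>i<N. \<Sum>j<N. of_real (R $$ (i, j)) * (cnj (x $ i) * x $ j))"
    using x R n M
    by (auto simp: scalar_prod_def atLeast0LessThan sum_distrib_left mult_ac MR intro!: sum.cong)
  \<comment> \<open>The mixed terms of \<open>a\<close> and \<open>b\<close> are purely
    imaginary.\<close>
  also have "Re \<dots> = (\<Sum>i<N. \<Sum>j<N. R $$ (i, j) * (a $ i * a $ j) + R $$ (i, j) * (b $ i * b $ j))"
    using x by (simp add: a_def b_def algebra_simps)
  also have "\<dots> = a \<bullet> (R *\<^sub>v a) + b \<bullet> (R *\<^sub>v b)"
    using ab by (simp add: q sum.distrib)
  finally have eq: "Re (conjugate x \<bullet> (M *\<^sub>v x)) = a \<bullet> (R *\<^sub>v a) + b \<bullet> (R *\<^sub>v b)" .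
  have "a \<noteq> 0\<^sub>v N \<or> b \<noteq> 0\<^sub>v N"
  proof (rule ccontr)
    assume "\<not> ?thesis"
    then have z: "a = 0\<^sub>v N" "b = 0\<^sub>v N" by auto
    have "x = 0\<^sub>v N"
    proof (rule eq_vecI)
      fix i assume i: "i < dim_vec (0\<^sub>v N :: complex vec)"
      then show "x $ i = 0\<^sub>v N $ i"
        using arg_cong[OF z(1), of "\<lambda>v. v $ i"] arg_cong[OF z(2), of "\<lambda>v. v $ i"] x
        by (simp add: a_def b_def complex_eq_iff)
    qed (use x in simp)
    then show False using x0 by simp
  qed
  then show "Re (conjugate x \<bullet> (M *\<^sub>v x)) > 0"
    unfolding eq using pos[of a] pos[of b] nn[of a] nn[of b] ab n by (metis add_pos_nonneg add_nonneg_pos)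
qed

text \<open>Diagonalise \<open>M\<close> unitarily by \<open>U\<close>. Its eigenvalues are
  positive, so \<open>L\<close> can be the square root of the diagonal matrix times
  \<open>U\<^sup>H\<close>, with inverse \<open>U\<close> times the inverse square root.\<close>

lemma positive_definite_factor:
  fixes M :: "complex mat"
  assumes M: "M \<in> carrier_mat n n" and herm: "mat_adjoint M = M"
    and pos: "\<And>x. x \<in> carrier_vec n \<Longrightarrow> x \<noteq> 0\<^sub>v n \<Longrightarrow> Re (conjugate x \<bullet> (M *\<^sub>v x)) > 0"
  shows "\<exists>L\<in>carrier_mat n n. \<exists>L'\<in>carrier_mat n n.
    M = mat_adjoint L * L \<and> L * L' = 1\<^sub>m n \<and> L' * L = 1\<^sub>m n"
proof -
  obtain es where "char_poly M = (\<Prod>e\<leftarrow>es. [:- e, 1:])"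
    using char_poly_factorized[OF M] by blast
  from hermitian_congruence_diag[OF M herm this] obtain U where U: "U \<in> carrier_mat n n"
    and UU: "mat_adjoint U * U = 1\<^sub>m n" and UM: "mat_adjoint U * M * U = mat_diag n ((!) es)"
    by blast
  have UH: "mat_adjoint U \<in> carrier_mat n n" using U by simp
  note UU' = unitary_right[OF U UU]
  define d where "d i = Re (es ! i)" for i
  have d: "d i > 0 \<and> es ! i = of_real (d i)" if i: "i < n" for i
  proof -
    have c: "col U i \<in> carrier_vec n" using col_dim[of U i] U by simp
    \<comment> \<open>The diagonal entry is the value of the form at the \<open>i\<close>-th column
      of \<open>U\<close>, so positivity of the form gives positivity of its real part.\<close>
    have ev: "es ! i = conjugate (col U i) \<bullet> (M *\<^sub>v col U i)"
    proof -
      have "es ! i = (mat_adjoint U * M * U) $$ (i, i)" using UM i by (simp add: mat_diag_def)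
      also have "\<dots> = (mat_adjoint U * (M * U)) $$ (i, i)"
        using assoc_mult_mat[OF UH M U] by simp
      also have "\<dots> = row (mat_adjoint U) i \<bullet> col (M * U) i" using U M i by simp
      also have "row (mat_adjoint U) i = conjugate (col U i)"
        using U i by (intro eq_vecI) (simp_all add: mat_adjoint_entry)
      also have "col (M * U) i = M *\<^sub>v col U i" by (rule col_mult2[OF M U i])
      finally show ?thesis .
    qed
    have "col U i \<noteq> 0\<^sub>v n"
    proof
      assume "col U i = 0\<^sub>v n"
      then have "(mat_adjoint U * U) $$ (i, i) = 0" using U i by simp
      then show False using UU i by simp
    qed
    then have "d i > 0" using pos[OF c] by (simp add: d_def ev)
    \<comment> \<open>The diagonalised matrix is again Hermitian, so its entries are real.\<close>
    moreover have "cnj (es ! i) = es ! i"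
    proof -
      have "mat_adjoint (mat_diag n ((!) es)) = mat_diag n ((!) es)"
        using mat_adjoint_congruence[OF M U] herm UM by simp
      from arg_cong[OF this, of "\<lambda>X. X $$ (i, i)"] show ?thesis
        using i by (simp add: mat_adjoint_entry mat_diag_def)
    qed
    ultimately show ?thesis by (simp add: d_def complex_eq_iff)
  qed
  define S S' where "S = mat_diag n (\<lambda>i. complex_of_real (sqrt (d i)))"
    and "S' = mat_diag n (\<lambda>i. complex_of_real (1 / sqrt (d i)))"
  have S: "S \<in> carrier_mat n n" "S' \<in> carrier_mat n n" by (simp_all add: S_def S'_def)
  have SS: "S * S' = 1\<^sub>m n" "S' * S = 1\<^sub>m n"
  proof -
    have "sqrt (d i) * (1 / sqrt (d i)) = 1" if "i < n" for i using d[OF that] by simp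
    then have *: "complex_of_real (sqrt (d i)) * complex_of_real (1 / sqrt (d i)) = 1" if "i < n" for i
      using that by (metis of_real_1 of_real_mult)
    show "S * S' = 1\<^sub>m n" "S' * S = 1\<^sub>m n"
      unfolding S_def S'_def mat_diag_diag
      by (rule eq_matI; use * in \<open>simp add: mat_diag_def mult.commute\<close>)+
  qed
  have SHS: "mat_adjoint S * S = mat_diag n ((!) es)"
  proof -
    have "complex_of_real (sqrt (d i)) * complex_of_real (sqrt (d i)) = es ! i" if "i < n" for i
      using d[OF that] by (metis less_imp_le of_real_mult real_sqrt_mult_self abs_of_pos)
    then show ?thesis
      unfolding S_def mat_adjoint_mat_diag mat_diag_diag
      by (intro eq_matI) (simp_all add: mat_diag_def)
  qed
  have SH: "mat_adjoint S \<in> carrier_mat n n" using S by simp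
  define L L' where "L = S * mat_adjoint U" and "L' = U * S'"
  have L: "L \<in> carrier_mat n n" "L' \<in> carrier_mat n n"
    unfolding L_def L'_def using S U UH by (meson mult_carrier_mat)+
  \<comment> \<open>Inserting the identity turns the product into a congruence, to which the
    composition rule applies.\<close>
  have "mat_adjoint L * L = mat_adjoint L * 1\<^sub>m n * L" using L by simp
  also have "\<dots> = U * (mat_adjoint S * 1\<^sub>m n * S) * mat_adjoint U"
    unfolding L_def using mult_mat_congruence[OF one_carrier_mat S(1) UH] by simp
  also have "mat_adjoint S * 1\<^sub>m n * S = mat_adjoint U * M * U"
    using SHS UM right_mult_one_mat[OF SH] by simp
  also have "U * (mat_adjoint U * M * U) * mat_adjoint U
      = mat_adjoint (U * mat_adjoint U) * M * (U * mat_adjoint U)"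
    using mult_mat_congruence[OF M U UH] by simp
  also have "\<dots> = M" using UU' M by simp
  finally have "M = mat_adjoint L * L" ..
  moreover have LL: "L * L' = 1\<^sub>m n"
  proof -
    have "L * L' = S * (mat_adjoint U * (U * S'))"
      unfolding L_def L'_def using S U UH by (intro assoc_mult_mat[of _ n n _ n _ n]) auto
    also have "mat_adjoint U * (U * S') = mat_adjoint U * U * S'"
      using S U UH by (intro assoc_mult_mat[symmetric, of _ n n _ n _ n]) auto
    finally show ?thesis using UU SS S by simp
  qed
  moreover have "L' * L = 1\<^sub>m n" using mat_mult_left_right_inverse[OF L LL] .
  ultimately show ?thesis using L by blast
qed

section \<open>Symmetry of the spectrum under negation\<close>

text \<open>Each list is, as a multiset, the roots of its product with multiplicity.\<close>

lemma prod_linear_factors_mset: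
  fixes es fs :: "'a::idom list"
  assumes "(\<Prod>e\<leftarrow>es. [:- e, 1:]) = (\<Prod>e\<leftarrow>fs. [:- e, 1:])"
  shows "mset es = mset fs"
proof -
  have "proots (\<Prod>e\<leftarrow>gs. [:- e, 1:]) = mset gs" for gs :: "'a list"
  proof (induction gs)
    case (Cons g gs)
    have "(\<Prod>e\<leftarrow>gs. [:- e, 1:]) \<noteq> 0" by (auto simp: prod_list_zero_iff)
    then show ?case using Cons by (simp add: proots_mult del: mult_pCons_left)
  qed simp
  then show ?thesis using assms by metis
qed

text \<open>Negation exchanges the positive and the negative members with their multiplicities, and
  0 does not occur. So \<open>xs\<close> can be the sublist of positive members.\<close>

lemma symmetric_mset_split:
  fixes es :: "complex list"
  assumes sym: "mset es = mset (map uminus es)" and real: "set es \<subseteq> \<real>" and nz: "0 \<notin> set es"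
  shows "\<exists>xs. mset es = mset (xs @ map uminus xs) \<and> (\<forall>x\<in>set xs. x \<in> \<real> \<and> Re x > 0)"
proof -
  let ?xs = "filter (\<lambda>x. Re x > 0) es"
  have "mset es = filter_mset (\<lambda>x. Re x > 0) (mset es) + filter_mset (\<lambda>x. \<not> Re x > 0) (mset es)"
    by (rule multiset_partition)
  also have "filter_mset (\<lambda>x. \<not> Re x > 0) (mset es) = filter_mset (\<lambda>x. Re x < 0) (mset es)"
  proof (rule filter_mset_cong[OF refl])
    fix x assume "x \<in># mset es"
    then have "x \<in> \<real>" "x \<noteq> 0" using real nz by auto
    then have "Re x \<noteq> 0" by (auto simp: complex_is_Real_iff complex_eq_iff)
    then show "(\<not> Re x > 0) = (Re x < 0)" by auto
  qed
  also have "\<dots> = filter_mset (\<lambda>x. Re x < 0) (image_mset uminus (mset es))"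
    using sym by simp
  also have "\<dots> = image_mset uminus (filter_mset (\<lambda>x. Re x > 0) (mset es))"
    by (simp add: filter_mset_image_mset)
  finally have "mset es = mset (?xs @ map uminus ?xs)" by simp
  moreover have "\<forall>x\<in>set ?xs. x \<in> \<real> \<and> Re x > 0" using real by auto
  ultimately show ?thesis by blast
qed

lemma smult_minus_one_mat: "(- 1) \<cdot>\<^sub>m A = - (A :: 'a::comm_ring_1 mat)"
  by (rule eq_matI) simp_all

text \<open>\<open>B\<close> is similar to the diagonal matrix of \<open>es\<close>, hence
  \<open>- B\<close> to its negative, whose characteristic polynomial is read off the
  diagonal.\<close>

lemma char_poly_uminus_hermitian:
  fixes B :: "complex mat"
  assumes B: "B \<in> carrier_mat n n" and herm: "mat_adjoint B = B"
    and cp: "char_poly B = (\<Prod>e\<leftarrow>es. [:- e, 1:])"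
  shows "char_poly (- B) = (\<Prod>e\<leftarrow>map uminus es. [:- e, 1:])"
proof -
  obtain V where V: "V \<in> carrier_mat n n" and VV: "mat_adjoint V * V = 1\<^sub>m n"
    and VB: "mat_adjoint V * B * V = mat_diag n ((!) es)"
    using hermitian_congruence_diag[OF assms] by blast
  have VH: "mat_adjoint V \<in> carrier_mat n n" using V by simp
  have len: "length es = n"
    using degree_monic_char_poly[OF B] degree_linear_factors[of uminus es] cp by simp
  have "similar_mat (mat_diag n ((!) es)) B"
    using V VH VV unitary_right[OF V VV] B
    by (intro similar_matI[of _ _ "mat_adjoint V" V n]) (auto simp: VB)
  then have "similar_mat ((- 1) \<cdot>\<^sub>m mat_diag n ((!) es)) ((- 1) \<cdot>\<^sub>m B)"
    by (rule similar_mat_smult)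
  then have "similar_mat (- mat_diag n ((!) es)) (- B)"
    by (simp add: smult_minus_one_mat)
  then have "char_poly (- B) = char_poly (- mat_diag n ((!) es))"
    using char_poly_similar by metis
  also have "\<dots> = (\<Prod>a\<leftarrow>diag_mat (- mat_diag n ((!) es)). [:- a, 1:])"
    by (rule char_poly_upper_triangular[of _ n]) (auto simp: mat_diag_def)
  also have "diag_mat (- mat_diag n ((!) es)) = map uminus es"
    using len by (intro nth_equalityI) (auto simp: diag_mat_def mat_diag_def)
  finally show ?thesis .
qed

text \<open>Let \<open>W\<close> be the inverse of the symmetric matrix \<open>L\<^sup>H L\<close>.
  The matrix in question is similar to \<open>X = K W\<close>; the transpose of \<open>X\<close> is
  \<open>- W K\<close>, which is similar to \<open>- K W = - X\<close>. Transposition and similarity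
  preserve the characteristic polynomial.\<close>

lemma char_poly_congruence_skew:
  fixes K L L' :: "complex mat"
  assumes K: "K \<in> carrier_mat n n" and L: "L \<in> carrier_mat n n" and L': "L' \<in> carrier_mat n n"
    and LL: "L * L' = 1\<^sub>m n" "L' * L = 1\<^sub>m n"
    and sym: "transpose_mat (mat_adjoint L * L) = mat_adjoint L * L" and skew: "transpose_mat K = - K"
  shows "char_poly (mat_adjoint L' * K * L') = char_poly (- (mat_adjoint L' * K * L'))"
proof -
  define B where "B = mat_adjoint L' * K * L'"
  define M where "M = mat_adjoint L * L"
  define W where "W = L' * mat_adjoint L'"
  define X where "X = K * W"
  have LH: "mat_adjoint L \<in> carrier_mat n n" "mat_adjoint L' \<in> carrier_mat n n" using L L' by simp_all
  note c = K L L' LH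
  have M: "M \<in> carrier_mat n n" and W: "W \<in> carrier_mat n n" and X: "X \<in> carrier_mat n n"
    and B: "B \<in> carrier_mat n n"
    unfolding X_def W_def M_def B_def using c by (auto intro!: carrier_matI)
  have adj: "mat_adjoint L' * mat_adjoint L = 1\<^sub>m n" "mat_adjoint L * mat_adjoint L' = 1\<^sub>m n"
    using mat_adjoint_mult[OF L L'] mat_adjoint_mult[OF L' L] LL mat_adjoint_one by metis+
  note assoc = assoc_mult_mat[of _ n n _ n _ n]
  have MW: "M * W = 1\<^sub>m n"
  proof -
    have "M * W = mat_adjoint L * (L * (L' * mat_adjoint L'))"
      unfolding M_def W_def using c by (intro assoc) auto
    also have "L * (L' * mat_adjoint L') = L * L' * mat_adjoint L'"
      using c by (intro assoc[symmetric]) auto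
    finally show ?thesis using LL adj c by simp
  qed
  then have WM: "W * M = 1\<^sub>m n" using mat_mult_left_right_inverse[OF M W] by simp
  \<comment> \<open>The inverse of a symmetric matrix is symmetric.\<close>
  have "transpose_mat W = W"
  proof -
    have "M * transpose_mat W = transpose_mat (W * M)"
      using sym transpose_mult[OF W M] by (simp add: M_def)
    then have "W * (M * transpose_mat W) = W" using WM W by simp
    then show ?thesis
      using assoc[OF W M, of "transpose_mat W"] W WM by simp
  qed
  then have XT: "transpose_mat X = W * - K"
    unfolding X_def using transpose_mult[OF K W] skew by simp
  \<comment> \<open>Conjugate \<open>X\<close> by \<open>mat_adjoint L'\<close>; the product
    \<open>W * mat_adjoint L\<close> collapses to \<open>L'\<close>.\<close>
  have simBX: "similar_mat B X"
  proof (rule similar_matI[of _ _ "mat_adjoint L'" "mat_adjoint L" n])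
    have "X * mat_adjoint L = K * (W * mat_adjoint L)" unfolding X_def by (rule assoc[OF K W LH(1)])
    also have "W * mat_adjoint L = L' * (mat_adjoint L' * mat_adjoint L)"
      unfolding W_def by (rule assoc[OF L' LH(2,1)])
    finally have "X * mat_adjoint L = K * L'" using adj c by simp
    then have "mat_adjoint L' * (X * mat_adjoint L) = B"
      unfolding B_def using assoc[OF LH(2) K L'] by simp
    then show "B = mat_adjoint L' * X * mat_adjoint L" using assoc[OF LH(2) X LH(1)] by simp
  qed (use adj c B X in auto)
  \<comment> \<open>Conjugation by \<open>W\<close>, whose inverse is \<open>M\<close>, exchanges
    the two factors cyclically.\<close>
  have "similar_mat (W * - K) (- X)"
  proof (rule similar_matI[of _ _ W M n])
    have mK: "- K \<in> carrier_mat n n" using K by simp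
    have "- X = - K * W" unfolding X_def using K W by (simp add: uminus_mult_left_mat)
    then have "- X * M = - K * (W * M)" using assoc[OF mK W M] by simp
    then have "- X * M = - K" using WM K by simp
    moreover have "W * - X * M = W * (- X * M)" using assoc[of W "- X" M] W X M by simp
    ultimately show "W * - K = W * - X * M" by simp
    show "{W * - K, - X, W, M} \<subseteq> carrier_mat n n" using W K X M by auto
  qed (use MW WM in auto)
  then have "char_poly (- X) = char_poly X"
    using char_poly_similar char_poly_transpose_mat[OF X] XT by metis
  moreover have "char_poly B = char_poly X" by (rule char_poly_similar[OF simBX])
  moreover have "char_poly (- B) = char_poly (- X)"
    using char_poly_similar[OF similar_mat_smult[OF simBX, of "- 1"]] by (simp add: smult_minus_one_mat)
  ultimately show ?thesis by (simp add: B_def)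
qed

section \<open>The normal form and symplectic diagonalisation of one slice\<close>

text \<open>For each index this is a 2 x 2 problem: \<open>\<i>J\<close> has orthogonal eigenvectors
  for 1 and -1, and scaling both to squared norm \<open>m j\<close> gives the two identities at
  once.\<close>

lemma williamson_normal_block:
  assumes "\<And>j. j < n \<Longrightarrow> m j > 0"
  shows "\<exists>R\<in>carrier_mat (2 * n) (2 * n).
    mat_adjoint R * (\<i> \<cdot>\<^sub>m symplectic_J n) * R =
      diag_blocks n (\<lambda>j. of_real (m j)) (\<lambda>_. 0) (\<lambda>_. 0) (\<lambda>j. - of_real (m j)) \<and>
    mat_adjoint R * diag_blocks n (\<lambda>j. of_real (1 / m j)) (\<lambda>_. 0) (\<lambda>_. 0) (\<lambda>j. of_real (1 / m j)) * R
      = 1\<^sub>m (2 * n)"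
proof -
  define s where "s j = complex_of_real (sqrt (m j / 2))" for j
  have s: "s j * s j * 2 = of_real (m j)" "cnj (s j) = s j" if "j < n" for j
  proof -
    have "sqrt (m j / 2) * sqrt (m j / 2) * 2 = m j" using assms[OF that] by simp
    then have "complex_of_real (sqrt (m j / 2) * sqrt (m j / 2) * 2) = of_real (m j)" by simp
    then show "s j * s j * 2 = of_real (m j)" by (simp only: s_def of_real_mult of_real_numeral)
    show "cnj (s j) = s j" by (simp add: s_def)
  qed
  \<comment> \<open>At index \<open>j\<close> the columns are \<open>s j\<close> times
    \<open>(1, -\<i>)\<close> and \<open>(1, \<i>)\<close>, the eigenvectors of \<open>\<i>J\<close>
    for 1 and -1; their squared norm is \<open>2 * s j * s j = m j\<close>.\<close>
  define R where "R = diag_blocks n s s (\<lambda>j. - \<i> * s j) (\<lambda>j. \<i> * s j)"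
  have "mat_adjoint R * (\<i> \<cdot>\<^sub>m symplectic_J n) * R =
      diag_blocks n (\<lambda>j. of_real (m j)) (\<lambda>_. 0) (\<lambda>_. 0) (\<lambda>j. - of_real (m j))"
    unfolding R_def symplectic_J_eq diag_blocks_adjoint diag_blocks_smult diag_blocks_mult
    by (rule diag_blocks_cong) (simp_all add: s(2) s(1)[symmetric] algebra_simps)
  moreover have "mat_adjoint R *
      diag_blocks n (\<lambda>j. of_real (1 / m j)) (\<lambda>_. 0) (\<lambda>_. 0) (\<lambda>j. of_real (1 / m j)) * R = 1\<^sub>m (2 * n)"
    unfolding R_def diag_blocks_one diag_blocks_adjoint diag_blocks_mult
  proof (rule diag_blocks_cong)
    fix j assume j: "j < n"
    have "s j * s j * of_real (1 / m j) * 2 = of_real (m j) * of_real (1 / m j)"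
      using s(1)[OF j] by (simp add: mult_ac)
    also have "\<dots> = 1" using assms[OF j] by simp
    finally have *: "s j * s j * of_real (1 / m j) * 2 = 1" .
    show "(cnj (s j) * complex_of_real (1 / m j) + cnj (- \<i> * s j) * 0) * s j +
        (cnj (s j) * 0 + cnj (- \<i> * s j) * complex_of_real (1 / m j)) * (- \<i> * s j) = 1"
      using * s(2)[OF j] by (simp add: algebra_simps)
    show "(cnj (s j) * complex_of_real (1 / m j) + cnj (\<i> * s j) * 0) * s j +
        (cnj (s j) * 0 + cnj (\<i> * s j) * complex_of_real (1 / m j)) * (\<i> * s j) = 1"
      using * s(2)[OF j] by (simp add: algebra_simps)
  qed (simp_all add: s algebra_simps)
  moreover have "R \<in> carrier_mat (2 * n) (2 * n)" by (simp add: R_def)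
  ultimately show ?thesis by blast
qed

lemma smult_mat_cancel:
  fixes A B :: "'a::idom mat"
  assumes eq: "k \<cdot>\<^sub>m A = k \<cdot>\<^sub>m B" and k: "k \<noteq> 0"
  shows "A = B"
proof (rule eq_matI)
  show dim: "dim_row A = dim_row B" "dim_col A = dim_col B"
    using arg_cong[OF eq, of dim_row] arg_cong[OF eq, of dim_col] by simp_all
  fix i j assume "i < dim_row B" "j < dim_col B"
  then show "A $$ (i, j) = B $$ (i, j)"
    using arg_cong[OF eq, of "\<lambda>X. X $$ (i, j)"] dim k by simp
qed

text \<open>Congruence by \<open>R\<close> takes \<open>K\<close> to \<open>E\<close> and
  \<open>D\<close> to the identity; congruence by \<open>W\<close> takes \<open>E\<close> to
  \<open>K\<close> and the identity to \<open>M\<close>. So \<open>S = R * W\<close> preserves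
  \<open>K\<close> and takes \<open>D\<close> to \<open>M\<close>.\<close>

lemma williamson:
  assumes M: "M \<in> carrier_mat (2 * n) (2 * n)" and pd: "real_sym_pos_def M"
  shows "\<exists>S\<in>carrier_mat (2 * n) (2 * n). \<exists>lam :: nat \<Rightarrow> real. (\<forall>j<n. lam j > 0) \<and>
    mat_adjoint S * symplectic_J n * S = symplectic_J n \<and>
    M = mat_adjoint S * diag_blocks n (\<lambda>j. of_real (lam j)) (\<lambda>_. 0) (\<lambda>_. 0) (\<lambda>j. of_real (lam j)) * S"
proof -
  let ?N = "2 * n" and ?J = "symplectic_J n"
  \<comment> \<open>The factor \<open>\<i>\<close> makes the skew-symmetric real matrix
    \<open>J\<close> Hermitian, so the spectral theorem applies; \<open>K\<close> is still
    skew-symmetric.\<close>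
  define K where "K = \<i> \<cdot>\<^sub>m ?J"
  have K: "K \<in> carrier_mat ?N ?N" and J: "?J \<in> carrier_mat ?N ?N"
    by (simp_all add: K_def symplectic_J_eq)
  have Kherm: "mat_adjoint K = K"
    by (simp add: K_def symplectic_J_eq diag_blocks_smult diag_blocks_adjoint)
  have Kskew: "transpose_mat K = - K"
    by (rule eq_matI) (auto simp: K_def symplectic_J_def)
  have KK: "K * K = 1\<^sub>m ?N"
    by (simp add: K_def symplectic_J_eq diag_blocks_smult diag_blocks_mult diag_blocks_one)
  obtain L L' where L: "L \<in> carrier_mat ?N ?N" and L': "L' \<in> carrier_mat ?N ?N"
    and Mfact: "M = mat_adjoint L * L" and LL: "L * L' = 1\<^sub>m ?N" "L' * L = 1\<^sub>m ?N"
    using positive_definite_factor[OF M] real_sym_pos_defD[OF M pd] by metis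
  define B where "B = mat_adjoint L' * K * L'"
  have B: "B \<in> carrier_mat ?N ?N" unfolding B_def using K L' by (intro carrier_matI) simp_all
  have Bherm: "mat_adjoint B = B" using mat_adjoint_congruence[OF K L'] Kherm by (simp add: B_def)
  have KB: "mat_adjoint L * B * L = K"
    using mult_mat_congruence[OF K L' L] LL K by (simp add: B_def)
  obtain es where cp: "char_poly B = (\<Prod>e\<leftarrow>es. [:- e, 1:])" and len: "length es = ?N"
    using char_poly_factorized[OF B] by blast
  have "mset es = mset (map uminus es)"
  proof (rule prod_linear_factors_mset)
    have "transpose_mat (mat_adjoint L * L) = mat_adjoint L * L"
      using real_sym_pos_defD(2)[OF M pd] Mfact by simp
    from char_poly_congruence_skew[OF K L L' LL this Kskew]
    show "(\<Prod>e\<leftarrow>es. [:- e, 1:]) = (\<Prod>e\<leftarrow>map uminus es. [:- e, 1:])"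
      using char_poly_uminus_hermitian[OF B Bherm cp] cp by (simp add: B_def)
  qed
  moreover have "set es \<subseteq> \<real>" using hermitian_congruence_diag[OF B Bherm cp] by blast
  \<comment> \<open>An eigenvalue 0 would make \<open>B\<close>, and with it the congruent matrix
    \<open>K\<close>, singular, but \<open>K\<close> is its own inverse.\<close>
  moreover have "0 \<notin> set es"
  proof
    assume "0 \<in> set es"
    have LB: "mat_adjoint L * B \<in> carrier_mat ?N ?N"
      by (rule mult_carrier_mat[OF mat_adjoint_carrier[OF L] B])
    from \<open>0 \<in> set es\<close> have "poly (char_poly B) 0 = 0" unfolding cp
      by (auto simp: poly_prod_list prod_list_zero_iff)
    moreover have "B + 0 \<cdot>\<^sub>m 1\<^sub>m ?N = B" using B by (intro eq_matI) simp_all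
    ultimately have "det B = 0"
      using eigenvalue_root_char_poly[OF B, of 0] eigenvalue_det[OF B, of 0] B
      by (simp add: char_matrix_def)
    then have "det (mat_adjoint L * B * L) = 0"
      using det_mult[OF mat_adjoint_carrier[OF L] B] det_mult[OF LB L] by simp
    moreover have "det K * det K = 1" using det_mult[OF K K] KK by simp
    ultimately show False using KB by simp
  qed
  ultimately obtain xs where xs: "mset es = mset (xs @ map uminus xs)"
    and pos: "\<forall>x\<in>set xs. x \<in> \<real> \<and> Re x > 0"
    using symmetric_mset_split by blast
  have lxs: "length xs = n" using arg_cong[OF xs, of size] len by simp
  define m where "m j = Re (xs ! j)" for j
  have m: "m j > 0" "xs ! j = of_real (m j)" if "j < n" for j
    using pos lxs that by (auto simp: m_def of_real_Re)
  \<comment> \<open>The product depends only on the multiset of roots, so the eigenvalues may be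
    listed with the positive ones first and their negatives in the same order after them.\<close>
  have cp': "char_poly B = (\<Prod>e\<leftarrow>xs @ map uminus xs. [:- e, 1:])"
    unfolding cp by (subst (1 2) prod_mset_prod_list[symmetric]) (simp only: mset_map xs)
  obtain V where V: "V \<in> carrier_mat ?N ?N" and VV: "mat_adjoint V * V = 1\<^sub>m ?N"
    and VB: "mat_adjoint V * B * V = mat_diag ?N ((!) (xs @ map uminus xs))"
    using hermitian_congruence_diag[OF B Bherm cp'] by blast
  have VH: "mat_adjoint V \<in> carrier_mat ?N ?N" using V by simp
  note VV' = unitary_right[OF V VV]
  define E where "E = diag_blocks n (\<lambda>j. of_real (m j)) (\<lambda>_. 0) (\<lambda>_. 0) (\<lambda>j. - of_real (m j))"
  have VB: "mat_adjoint V * B * V = E"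
    unfolding VB mat_diag_append[OF lxs, of "map uminus xs", simplified, OF lxs] E_def
    by (rule diag_blocks_cong) (simp_all add: m lxs)
  define W where "W = mat_adjoint V * L"
  have W: "W \<in> carrier_mat ?N ?N" unfolding W_def using VH L by simp
  \<comment> \<open>As \<open>V * W = L\<close>, congruence by \<open>W\<close> undoes the one by
    \<open>V\<close> and applies \<open>L\<close>.\<close>
  have cancel: "mat_adjoint W * (mat_adjoint V * X * V) * W = mat_adjoint L * X * L"
    if X: "X \<in> carrier_mat ?N ?N" for X
  proof -
    have VW: "V * W = L" unfolding W_def using assoc_mult_mat[OF V VH L] VV' L by simp
    show ?thesis using mult_mat_congruence[OF X V W] by (simp add: VW)
  qed
  have WE: "mat_adjoint W * E * W = K" using cancel[OF B] by (simp add: VB KB)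
  have WW: "mat_adjoint W * W = M"
    using cancel[of "1\<^sub>m ?N"] VH V VV W L by (simp add: Mfact right_mult_one_mat[of _ ?N])
  \<comment> \<open>The reciprocals of the positive eigenvalues of \<open>B\<close> become the
    numbers \<open>lam\<close>.\<close>
  define D where "D = diag_blocks n (\<lambda>j. of_real (1 / m j)) (\<lambda>_. 0) (\<lambda>_. 0) (\<lambda>j. of_real (1 / m j))"
  have D: "D \<in> carrier_mat ?N ?N" by (simp add: D_def)
  obtain R where R: "R \<in> carrier_mat ?N ?N" and RK: "mat_adjoint R * K * R = E"
    and RD: "mat_adjoint R * D * R = 1\<^sub>m ?N"
    using williamson_normal_block[of n m] m unfolding K_def D_def E_def by blast
  define S where "S = R * W"
  have S: "S \<in> carrier_mat ?N ?N" unfolding S_def using R W by simp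
  have "mat_adjoint S * K * S = K"
    unfolding S_def using mult_mat_congruence[OF K R W] RK WE by simp
  \<comment> \<open>The scalar \<open>\<i>\<close> passes through the congruence, so preserving
    \<open>K\<close> means preserving \<open>J\<close>.\<close>
  moreover have "mat_adjoint S * K * S = \<i> \<cdot>\<^sub>m (mat_adjoint S * ?J * S)"
  proof -
    have SH: "mat_adjoint S \<in> carrier_mat ?N ?N" using S by simp
    have "mat_adjoint S * K = \<i> \<cdot>\<^sub>m (mat_adjoint S * ?J)"
      unfolding K_def by (rule mult_smult_distrib[OF SH J])
    then show ?thesis by (simp only: mult_smult_assoc_mat[OF mult_carrier_mat[OF SH J] S])
  qed
  ultimately have "\<i> \<cdot>\<^sub>m (mat_adjoint S * ?J * S) = \<i> \<cdot>\<^sub>m ?J" by (simp only: K_def)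
  then have "mat_adjoint S * ?J * S = ?J" by (rule smult_mat_cancel) simp
  moreover have "M = mat_adjoint S * D * S"
    unfolding S_def using mult_mat_congruence[OF D R W] RD WW W by (simp add: right_mult_one_mat[of _ ?N])
  moreover have "\<forall>j<n. 1 / m j > 0" using m by simp
  ultimately show ?thesis using S unfolding D_def by (intro bexI[of _ S] exI[of _ "\<lambda>j. 1 / m j"]) auto
qed

section \<open>From the slices back to tensors\<close>

theorem theorem3p15:
  fixes n p :: nat and M :: ctensor
  assumes "n \<ge> 1" and "p \<ge> 1"
    and "M \<in> carrier_tensor (2 * n) (2 * n) p"
    and "\<forall>i<p. real_sym_pos_def (fourier_slice M i)"
  shows "\<exists>S D. T_symplectic n p S \<and>
      D \<in> carrier_tensor (2 * n) (2 * n) p \<and> T_diagonal D \<and>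
      M = tadjoint S *\<^sub>T D *\<^sub>T S \<and>
      (\<forall>i<p. \<exists>lam :: nat \<Rightarrow> real. (\<forall>j<n. lam j > 0) \<and>
        (let L = mat_diag n (\<lambda>j. complex_of_real (lam j))
         in fourier_slice D i = four_block_mat L (0\<^sub>m n n) (0\<^sub>m n n) L))"
proof -
  let ?N = "2 * n"
  note p = assms(2) and M = assms(3)
  define G where "G lam = diag_blocks n (\<lambda>j. of_real (lam j)) (\<lambda>_. 0) (\<lambda>_. 0) (\<lambda>j. of_real (lam j))"
    for lam :: "nat \<Rightarrow> real"
  have G: "G lam \<in> carrier_mat ?N ?N" for lam by (simp add: G_def)
  \<comment> \<open>The bound on \<open>i\<close> stands inside the existential, so that choice
    yields functions \<open>SF\<close> and \<open>lam\<close> defined at every index.\<close>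
  have "\<forall>i. \<exists>S lam. i < p \<longrightarrow> S \<in> carrier_mat ?N ?N \<and> (\<forall>j<n. lam j > 0) \<and>
    mat_adjoint S * symplectic_J n * S = symplectic_J n \<and>
    fourier_slice M i = mat_adjoint S * G lam * S"
    using williamson[OF fourier_slice_carrier[OF M p]] assms(4) unfolding G_def by meson
  then obtain SF lam where SF: "\<And>i. i < p \<Longrightarrow> SF i \<in> carrier_mat ?N ?N"
    and lam: "\<And>i j. i < p \<Longrightarrow> j < n \<Longrightarrow> lam i j > 0"
    and SJ: "\<And>i. i < p \<Longrightarrow> mat_adjoint (SF i) * symplectic_J n * SF i = symplectic_J n"
    and SM: "\<And>i. i < p \<Longrightarrow> fourier_slice M i = mat_adjoint (SF i) * G (lam i) * SF i"
    by metis
  define S D where "S = inverse_fourier ?N ?N p SF" and "D = inverse_fourier ?N ?N p (\<lambda>i. G (lam i))"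
  have S: "S \<in> carrier_tensor ?N ?N p" and D: "D \<in> carrier_tensor ?N ?N p"
    unfolding S_def D_def by (rule inverse_fourier_carrier)+
  have fS: "fourier_slice S i = SF i" and fD: "fourier_slice D i = G (lam i)" if "i < p" for i
    unfolding S_def D_def
    using fourier_slice_inverse_fourier[OF that] SF[OF that] G by auto
  have blocks: "G l = four_block_mat (mat_diag n (\<lambda>j. complex_of_real (l j))) (0\<^sub>m n n) (0\<^sub>m n n)
      (mat_diag n (\<lambda>j. complex_of_real (l j)))" for l
    by (rule eq_matI) (auto simp: G_def diag_blocks_def mat_diag_def)
  \<comment> \<open>Tensor congruences are checked slicewise; this serves both for the symplectic
    condition and for the factorisation of \<open>M\<close>.\<close>
  have congr: "tadjoint S *\<^sub>T X *\<^sub>T S = Y"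
    if X: "X \<in> carrier_tensor ?N ?N p" and Y: "Y \<in> carrier_tensor ?N ?N p"
      and eq: "\<And>i. i < p \<Longrightarrow> mat_adjoint (SF i) * fourier_slice X i * SF i = fourier_slice Y i" for X Y
  proof -
    note SH = tadjoint_carrier[OF S]
    note SX = tprod(1)[OF SH X p]
    show ?thesis
      by (rule fourier_slice_inject[OF tprod(1)[OF SX S p] Y])
        (simp add: fourier_slice_tprod[OF SX S p] fourier_slice_tprod[OF SH X p]
          fourier_slice_tadjoint[OF S p] fS eq)
  qed
  have "T_symplectic n p S"
    unfolding T_symplectic_def
    using S congr[OF tsymplectic_unit_carrier tsymplectic_unit_carrier]
    by (simp add: fourier_slice_tsymplectic_unit SJ)
  moreover have "M = tadjoint S *\<^sub>T D *\<^sub>T S"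
    using congr[OF D M] by (simp add: fD SM)
  moreover have "T_diagonal D"
    unfolding T_diagonal_def
  proof (intro conjI exI allI impI)
    show "D \<in> carrier_tensor ?N ?N (length D)" using D carrier_tensorD(1)[OF D] by simp
    fix i assume "i < length D"
    then have i: "i < p" using carrier_tensorD(1)[OF D] by simp
    show "diagonal_mat (fourier_slice D i)"
      unfolding fD[OF i] blocks by (auto simp: diagonal_mat_def mat_diag_def)
  qed
  moreover have "\<forall>i<p. \<exists>lam :: nat \<Rightarrow> real. (\<forall>j<n. lam j > 0) \<and>
      (let L = mat_diag n (\<lambda>j. complex_of_real (lam j))
       in fourier_slice D i = four_block_mat L (0\<^sub>m n n) (0\<^sub>m n n) L)"
  proof (intro allI impI)
    fix i assume i: "i < p"
    show "\<exists>lam :: nat \<Rightarrow> real. (\<forall>j<n. lam j > 0) \<and>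
        (let L = mat_diag n (\<lambda>j. complex_of_real (lam j))
         in fourier_slice D i = four_block_mat L (0\<^sub>m n n) (0\<^sub>m n n) L)"
      unfolding Let_def fD[OF i] blocks using lam[OF i] by (intro exI[of _ "lam i"]) simp
  qed
  ultimately show ?thesis using D by (intro exI[of _ S, OF exI[of _ D]] conjI)
qed

end
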